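(* Let $\mathsf{X}$ be a subshift over an alphabet $\mathscr{A}$, let $\mathbb{F}$ be the free group generated by $\mathscr{A}$, let $R$ be a nonzero commutative unital indecomposable ring, and let $\widehat{\theta}$ be the topological partial action of $\mathbb{F}$ on $\Omega_{\mathcal{R}}$ associated with $\mathsf{X}$ (defined in the context). Then $\widehat{\theta}$ is minimal if and only if $\mathsf{X}$ is compactly cofinal. Moreover, if the alphabet $\mathscr{A}$ is countable, then $\widehat{\theta}$ is minimal if and only if $\mathsf{X}$ is sequentially cofinal.
   Context: Subshifts. $\mathscr{A}$ is a non-empty set (alphabet), $\omega$ the empty word. A subshift $\mathsf{X}\subseteq\mathscr{A}^{\mathbb{N}}$ is the set of all sequences none of whose finite subwords lies in some given set of words. $\mathcal{L}_{\mathsf{X}}$ is the language: the set of all finite words (including $\omega$) occurring in elements of $\mathsf{X}$. For finite words $\alpha,\beta$, $C(\alpha,\beta)=\{\beta x\in\mathsf{X}:\alpha x\in\mathsf{X}\}$ (empty if $\alpha$ or $\beta$ is not in $\mathcal{L}_{\mathsf{X}}$). $F_\beta=C(\beta,\omega)=\{x\in\mathsf{X}:\beta x\in\mathsf{X}\}$ and, for $B\subseteq\mathcal{L}_{\mathsf{X}}$, $F_B=\bigcap_{\beta\in B}F_\beta$. $\mathsf{X}$ is sequentially cofinal if for every finite $B\subseteq\mathcal{L}_{\mathsf{X}}$ with $F_B\neq\emptyset$ and every sequence $(x_n)_{n\in\mathbb{N}}$ in $\mathsf{X}$, there are $\alpha,\gamma\in\mathcal{L}_{\mathsf{X}}$ and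 a subsequence $(x_{n_k})_{k\in\mathbb{N}}$ such that $x_{n_k}\in C(\beta\gamma,\alpha)$ for all $k\in\mathbb{N}$ and all $\beta\in B$. $\mathsf{X}$ is compactly cofinal if for every finite $B\subseteq\mathcal{L}_{\mathsf{X}}$ with $F_B\neq\emptyset$ and every net $(x_i)_{i\in I}$ in $\mathsf{X}$, there are $\alpha,\gamma\in\mathcal{L}_{\mathsf{X}}$ and a subnet $(x_{i_j})_{j\in J}$ such that $x_{i_j}\in C(\beta\gamma,\alpha)$ for all $j\in J$ and all $\beta\in B$. Subshift algebra. $\mathcal{U}$ is the Boolean algebra of subsets of $\mathsf{X}$ generated by all $C(\alpha,\beta)$, $\alpha,\beta\in\mathcal{L}_{\mathsf{X}}$. $\widetilde{\mathcal{A}}_R(\mathsf{X})$ is the universal unital $R$-algebra with generators $\{p_A:A\in\mathcal{U}\}\cup\{s_a,s_a^*:a\in\mathscr{A}\}$ subject to: (i) $p_{\mathsf{X}}=1$, $p_\emptyset=0$, $p_{A\cap B}=p_Ap_B$, $p_{A\cup B}=p_A+p_B-p_{A\cap B}$; (ii) $s_as_a^*s_a=s_a$, $s_a^*s_as_a^*=s_a^*$; (iii) $s_\beta s_\alpha^*s_\alpha s_\beta^*=p_{C(\alpha,\beta)}$ for $\alpha,\beta\in\mathcal{L}_{\mathsf{X}}$, where $s_\omega=s_\omega^*=1$, $s_{\alpha_1\cdots\alpha_n}=s_{\alpha_1}\cdots s_{\alpha_n}$, $s_{\alpha_1\cdots\alpha_n}^*=s_{\alpha_n}^*\cdots s_{\alpha_1}^*$.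 Let $\pi:\mathbb{F}\to\widetilde{\mathcal{A}}_R(\mathsf{X})$ be $\pi(g)=s_\alpha s_\beta^*$ if $g$ has reduced form $\alpha\beta^{-1}$ with $\alpha,\beta\in\mathcal{L}_{\mathsf{X}}$, and $\pi(g)=0$ otherwise. Relations and the partial action. Let $$\mathcal{R}=\Big\{\sum_{i}\lambda_i\prod_j\varepsilon_{\beta_{ij}\gamma_{ij}^{-1}}:\ \sum_{i}\lambda_i\prod_{j}p_{C(\gamma_{ij},\beta_{ij})}=0\text{ in }\widetilde{\mathcal{A}}_R(\mathsf{X})\Big\}\cup\{\varepsilon_g:\pi(g)=0\}$$ (finite sums and products of formal symbols $\varepsilon_g$, $g\in\mathbb{F}$; $\lambda_i\in R$; $\beta_{ij},\gamma_{ij}\in\mathcal{L}_{\mathsf{X}}$). Let $X_{\mathbb{F}}=\{\xi\subseteq\mathbb{F}:\omega\in\xi\}$ with the topology induced from $\{0,1\}^{\mathbb{F}}$ ($\omega$ being the identity of $\mathbb{F}$), let $1_g$ be the characteristic function of $\{\xi\in X_{\mathbb{F}}:g\in\xi\}$, and let $\Theta(\mathcal{R})$ be the set of functions $X_{\mathbb{F}}\to R$ obtained from the elements of $\mathcal{R}$ by replacing each $\varepsilon_g$ by $1_g$. Put $\Omega_{\mathcal{R}}=\{\xi\in X_{\mathbb{F}}:f(g^{-1}\xi)=0\ \forall f\in\Theta(\mathcal{R}),\ \forall g\in\xi\}$, $\Omega_g=\{\xi\in\Omega_{\mathcal{R}}:g\in\xi\}$ and $\widehat\theta_g:\Omega_{g^{-1}}\to\Omega_g$,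 $\widehat\theta_g(\xi)=g\xi=\{gh:h\in\xi\}$. This is a topological partial action of $\mathbb{F}$ on $\Omega_{\mathcal{R}}$. It is minimal if for every $\xi\in\Omega_{\mathcal{R}}$ the orbit $\operatorname{Orb}(\xi)=\{\widehat\theta_g(\xi):g\in\mathbb{F},\ \xi\in\Omega_{g^{-1}}\}$ is dense in $\Omega_{\mathcal{R}}$. Indecomposable: the only idempotents of $R$ are $0$ and $1$.
   Formalization: In the first kind of relations in 𝓡, the products β_ij γ_ij^{-1} are required to be in reduced form; without this, ε_{aa^{-1}} = ε_{bb^{-1}} = ε_ω and p_{C(a,a)}p_{C(b,b)} = 0 would make Ω_𝓡 empty, so the equivalence would fail, e.g. for X = {a^∞, b^∞}. *)

theory Defs
  imports
    "HOL-Analysis.Function_Topology"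
    "HOL-Algebra.QuotRing"
    "HOL-Library.Poly_Mapping"
    "HOL-Library.Omega_Words_Fun"
    "HOL-Library.Countable_Set"
begin

section \<open>Subshifts\<close>

text \<open>The alphabet is the type \<^typ>\<open>'a\<close>, \<open>w \<frown> x\<close> is concatenation of a finite word and a sequence,
  and \<open>x [i \<rightarrow> j]\<close> is the subword of \<open>x\<close> at the positions \<open>i, \<dots>, j - 1\<close> (empty if \<open>j \<le> i\<close>).\<close>

definition subshift :: "(nat \<Rightarrow> 'a) set \<Rightarrow> bool" where
  "subshift X \<longleftrightarrow> (\<exists>W. X = {x. \<forall>i j. x [i \<rightarrow> j] \<notin> W})"

definition lang :: "(nat \<Rightarrow> 'a) set \<Rightarrow> 'a list set" where
  "lang X = insert [] {w. \<exists>x\<in>X. \<exists>i j. w = x [i \<rightarrow> j]}"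

definition cyl :: "(nat \<Rightarrow> 'a) set \<Rightarrow> 'a list \<Rightarrow> 'a list \<Rightarrow> (nat \<Rightarrow> 'a) set" where
  "cyl X \<alpha> \<beta> = {\<beta> \<frown> x |x. \<beta> \<frown> x \<in> X \<and> \<alpha> \<frown> x \<in> X}"

lemma cyl_empty_if_not_lang:
  assumes "\<alpha> \<notin> lang X \<or> \<beta> \<notin> lang X"
  shows "cyl X \<alpha> \<beta> = {}"
proof -
  have "w \<in> lang X" if "w \<frown> x \<in> X" for w x
    unfolding lang_def
    by (intro insertI2 CollectI bexI[OF _ that] exI[of _ 0] exI[of _ "length w"])
      (simp add: prefix_conc_length)
  with assms show ?thesis unfolding cyl_def by blast
qed

definition follower :: "(nat \<Rightarrow> 'a) set \<Rightarrow> 'a list \<Rightarrow> (nat \<Rightarrow> 'a) set" where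
  "follower X \<beta> = cyl X \<beta> []"

text \<open>The intersection is taken inside \<open>X\<close>, so that it is \<open>X\<close> for \<open>B = {}\<close>.\<close>

definition followers :: "(nat \<Rightarrow> 'a) set \<Rightarrow> 'a list set \<Rightarrow> (nat \<Rightarrow> 'a) set" where
  "followers X B = X \<inter> (\<Inter>\<beta>\<in>B. follower X \<beta>)"

definition sequentially_cofinal :: "(nat \<Rightarrow> 'a) set \<Rightarrow> bool" where
  "sequentially_cofinal X \<longleftrightarrow>
     (\<forall>B. finite B \<and> B \<subseteq> lang X \<and> followers X B \<noteq> {} \<longrightarrow>
       (\<forall>x :: nat \<Rightarrow> (nat \<Rightarrow> 'a). (\<forall>n. x n \<in> X) \<longrightarrow>
         (\<exists>\<alpha>\<in>lang X. \<exists>\<gamma>\<in>lang X. \<exists>r :: nat \<Rightarrow> nat. strict_mono r \<and>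
            (\<forall>k. \<forall>\<beta>\<in>B. x (r k) \<in> cyl X (\<beta> @ \<gamma>) \<alpha>))))"

subsection \<open>Nets and compact cofinality\<close>

definition directed_set :: "'i set \<Rightarrow> ('i \<Rightarrow> 'i \<Rightarrow> bool) \<Rightarrow> bool" where
  "directed_set I leI \<longleftrightarrow> I \<noteq> {} \<and> reflp_on I leI \<and> transp_on I leI \<and>
     (\<forall>i\<in>I. \<forall>j\<in>I. \<exists>k\<in>I. leI i k \<and> leI j k)"

text \<open>\<open>h\<close> exhibits \<open>(x (h j))\<close>, \<open>j \<in> J\<close>, as a subnet of a net \<open>(x i)\<close>, \<open>i \<in> I\<close>.\<close>

definition subnet_map ::
  "'j set \<Rightarrow> ('j \<Rightarrow> 'j \<Rightarrow> bool) \<Rightarrow> 'i set \<Rightarrow> ('i \<Rightarrow> 'i \<Rightarrow> bool) \<Rightarrow> ('j \<Rightarrow> 'i) \<Rightarrow> bool" where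
  "subnet_map J leJ I leI h \<longleftrightarrow> directed_set J leJ \<and> h ` J \<subseteq> I \<and>
     monotone_on J leJ leI h \<and> (\<forall>i\<in>I. \<exists>j\<in>J. leI i (h j))"

definition compactly_cofinal_wrt ::
  "'i itself \<Rightarrow> 'j itself \<Rightarrow> (nat \<Rightarrow> 'a) set \<Rightarrow> bool" where
  "compactly_cofinal_wrt TI TJ X \<longleftrightarrow>
     (\<forall>B. finite B \<and> B \<subseteq> lang X \<and> followers X B \<noteq> {} \<longrightarrow>
       (\<forall>(I :: 'i set) leI (x :: 'i \<Rightarrow> (nat \<Rightarrow> 'a)).
          directed_set I leI \<and> (\<forall>i\<in>I. x i \<in> X) \<longrightarrow>
         (\<exists>\<alpha>\<in>lang X. \<exists>\<gamma>\<in>lang X. \<exists>(J :: 'j set) leJ h. subnet_map J leJ I leI h \<and>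
            (\<forall>j\<in>J. \<forall>\<beta>\<in>B. x (h j) \<in> cyl X (\<beta> @ \<gamma>) \<alpha>))))"

text \<open>HOL cannot quantify over all index types inside a formula. We index nets in the sequence
  space by subsets of the type of pairs (set of points, point), the index type of the canonical
  net of a filter; the lemmas below show that this covers nets and subnets over
  index sets of every type.\<close>

type_synonym 'x net_index = "'x set \<times> 'x"

definition compactly_cofinal :: "(nat \<Rightarrow> 'a) set \<Rightarrow> bool" where
  "compactly_cofinal X \<longleftrightarrow>
     compactly_cofinal_wrt TYPE((nat \<Rightarrow> 'a) net_index) TYPE((nat \<Rightarrow> 'a) net_index) X"

lemma subnet_in_set_iff:
  fixes I :: "'i set" and x :: "'i \<Rightarrow> 'x"
  assumes I: "directed_set I leI"
  shows "(\<exists>(J :: 'i set) leJ h. subnet_map J leJ I leI h \<and> (\<forall>j\<in>J. x (h j) \<in> Y))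
    \<longleftrightarrow> (\<forall>i\<in>I. \<exists>k\<in>I. leI i k \<and> x k \<in> Y)" (is "?L \<longleftrightarrow> ?R")
proof
  assume ?L
  then show ?R unfolding subnet_map_def by blast
next
  assume R: ?R
  define J where "J = {i\<in>I. x i \<in> Y}"
  have sub: "J \<subseteq> I" by (auto simp: J_def)
  have "J \<noteq> {}" using I R by (auto simp: directed_set_def J_def)
  moreover have "\<exists>k\<in>J. leI i k \<and> leI j k" if ij: "i \<in> J" "j \<in> J" for i j
  proof -
    obtain k where k: "k \<in> I" "leI i k" "leI j k"
      using I ij sub unfolding directed_set_def by blast
    obtain l where l: "l \<in> I" "leI k l" "x l \<in> Y" using R k by blast
    have "transp_on I leI" using I by (simp add: directed_set_def)
    then have "leI i l" "leI j l" using k l ij sub by (meson subsetD transp_onD)+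
    with l show ?thesis by (auto simp: J_def)
  qed
  ultimately have dJ: "directed_set J leI"
    using I sub unfolding directed_set_def by (meson reflp_on_subset transp_on_subset)
  have "subnet_map J leI I leI (\<lambda>i. i)"
    using dJ sub R by (auto simp: subnet_map_def J_def intro: monotone_onI)
  then show ?L by (intro exI[of _ J] exI[of _ leI] exI[of _ "\<lambda>i. i"]) (auto simp: J_def)
qed

lemma compactly_cofinal_iff:
  "compactly_cofinal_wrt TYPE('i) TYPE('i) X \<longleftrightarrow>
     (\<forall>B. finite B \<and> B \<subseteq> lang X \<and> followers X B \<noteq> {} \<longrightarrow>
       (\<forall>(I :: 'i set) leI x. directed_set I leI \<and> (\<forall>i\<in>I. x i \<in> X) \<longrightarrow>
         (\<exists>\<alpha>\<in>lang X. \<exists>\<gamma>\<in>lang X. \<forall>i\<in>I. \<exists>k\<in>I. leI i k \<and>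
            (\<forall>\<beta>\<in>B. x k \<in> cyl X (\<beta> @ \<gamma>) \<alpha>))))"
proof -
  have *: "(\<exists>(J :: 'i set) leJ h. subnet_map J leJ I leI h \<and>
            (\<forall>j\<in>J. \<forall>\<beta>\<in>B. x (h j) \<in> cyl X (\<beta> @ \<gamma>) \<alpha>)) \<longleftrightarrow>
        (\<forall>i\<in>I. \<exists>k\<in>I. leI i k \<and> (\<forall>\<beta>\<in>B. x k \<in> cyl X (\<beta> @ \<gamma>) \<alpha>))"
    if "directed_set I leI" for I :: "'i set" and leI x B \<alpha> \<gamma>
    using subnet_in_set_iff[OF that, of x "{y. \<forall>\<beta>\<in>B. y \<in> cyl X (\<beta> @ \<gamma>) \<alpha>}"] by simp
  show ?thesis unfolding compactly_cofinal_wrt_def by (simp add: * cong: conj_cong)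
qed

lemma compactly_cofinal_all_nets:
  fixes X :: "(nat \<Rightarrow> 'a) set"
  assumes "compactly_cofinal X"
  shows "compactly_cofinal_wrt TYPE('i) TYPE('i) X"
  unfolding compactly_cofinal_iff
proof (intro allI impI)
  fix B and I :: "'i set" and leI and x :: "'i \<Rightarrow> (nat \<Rightarrow> 'a)"
  assume B: "finite B \<and> B \<subseteq> lang X \<and> followers X B \<noteq> {}"
    and net: "directed_set I leI \<and> (\<forall>i\<in>I. x i \<in> X)"
  define T where "T i = x ` {k\<in>I. leI i k}" for i
  define I' where "I' = {(S, y). \<exists>i\<in>I. S = T i \<and> y \<in> S}"
  define le' where "le' p q \<longleftrightarrow> fst q \<subseteq> fst p" for p q :: "(nat \<Rightarrow> 'a) net_index"
  have refl: "leI i i" if "i \<in> I" for i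
    using net that by (simp add: directed_set_def reflp_on_def)
  have trans: "leI i k" if "leI i j" "leI j k" "i \<in> I" "j \<in> I" "k \<in> I" for i j k
    using net that by (meson directed_set_def transp_onD)
  have mem: "(T i, x i) \<in> I'" if "i \<in> I" for i
    using that refl by (auto simp: I'_def T_def)
  have Tmono: "T k \<subseteq> T i" if "leI i k" "i \<in> I" "k \<in> I" for i k
    using that trans by (auto simp: T_def)
  have "\<exists>r\<in>I'. le' p r \<and> le' q r" if pq: "p \<in> I'" "q \<in> I'" for p q
  proof -
    obtain i j where ij: "i \<in> I" "fst p = T i" "j \<in> I" "fst q = T j"
      using pq by (auto simp: I'_def)
    obtain k where "k \<in> I" "leI i k" "leI j k"
      using net ij unfolding directed_set_def by blast
    then show ?thesis using ij Tmono mem by (intro bexI[of _ "(T k, x k)"]) (auto simp: le'_def)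
  qed
  moreover have "I' \<noteq> {}" using net mem by (auto simp: directed_set_def)
  ultimately have dir: "directed_set I' le'"
    by (auto simp: directed_set_def le'_def reflp_on_def transp_on_def)
  have "\<forall>p\<in>I'. snd p \<in> X" using net by (auto simp: I'_def T_def)
  with dir have net': "directed_set I' le' \<and> (\<forall>p\<in>I'. snd p \<in> X)" ..
  obtain \<alpha> \<gamma> where \<alpha>\<gamma>: "\<alpha> \<in> lang X" "\<gamma> \<in> lang X"
    and fr: "\<forall>p\<in>I'. \<exists>q\<in>I'. le' p q \<and> (\<forall>\<beta>\<in>B. snd q \<in> cyl X (\<beta> @ \<gamma>) \<alpha>)"
    using assms[unfolded compactly_cofinal_def compactly_cofinal_iff, rule_format, OF B net'] by auto
  have "\<exists>k\<in>I. leI i k \<and> (\<forall>\<beta>\<in>B. x k \<in> cyl X (\<beta> @ \<gamma>) \<alpha>)" if i: "i \<in> I" for i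
  proof -
    obtain q where "q \<in> I'" "le' (T i, x i) q" "\<forall>\<beta>\<in>B. snd q \<in> cyl X (\<beta> @ \<gamma>) \<alpha>"
      using fr mem[OF i] by blast
    moreover from this have "snd q \<in> T i" by (auto simp: I'_def le'_def)
    ultimately show ?thesis unfolding T_def by auto
  qed
  with \<alpha>\<gamma> show "\<exists>\<alpha>\<in>lang X. \<exists>\<gamma>\<in>lang X. \<forall>i\<in>I. \<exists>k\<in>I. leI i k \<and>
      (\<forall>\<beta>\<in>B. x k \<in> cyl X (\<beta> @ \<gamma>) \<alpha>)" by blast
qed

lemma compactly_cofinal_wrt_subnet_index:
  assumes "compactly_cofinal_wrt TYPE('i) TYPE('j) X"
  shows "compactly_cofinal_wrt TYPE('i) TYPE('i) X"
  unfolding compactly_cofinal_iff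
proof (intro allI impI)
  fix B and I :: "'i set" and leI and x
  assume B: "finite B \<and> B \<subseteq> lang X \<and> followers X B \<noteq> {}"
    and net: "directed_set I leI \<and> (\<forall>i\<in>I. x i \<in> X)"
  obtain \<alpha> \<gamma> J and leJ :: "'j \<Rightarrow> 'j \<Rightarrow> bool" and h
    where *: "\<alpha> \<in> lang X" "\<gamma> \<in> lang X" "subnet_map J leJ I leI h"
      "\<forall>j\<in>J. \<forall>\<beta>\<in>B. x (h j) \<in> cyl X (\<beta> @ \<gamma>) \<alpha>"
    using assms[unfolded compactly_cofinal_wrt_def, rule_format, OF B net] by auto
  then have "\<forall>i\<in>I. \<exists>k\<in>I. leI i k \<and> (\<forall>\<beta>\<in>B. x k \<in> cyl X (\<beta> @ \<gamma>) \<alpha>)"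
    unfolding subnet_map_def by blast
  with * show "\<exists>\<alpha>\<in>lang X. \<exists>\<gamma>\<in>lang X. \<forall>i\<in>I. \<exists>k\<in>I. leI i k \<and>
      (\<forall>\<beta>\<in>B. x k \<in> cyl X (\<beta> @ \<gamma>) \<alpha>)" by blast
qed


section \<open>The free group\<close>

text \<open>\<open>(a, True)\<close> stands for the generator \<open>a\<close> and \<open>(a, False)\<close> for its inverse. The group is
  written additively because the library's type class of not necessarily commutative
  groups, \<^class>\<open>group_add\<close>, is additive: \<open>g h\<close> is \<open>g + h\<close>, \<open>g\<inverse>\<close> is \<open>- g\<close>, and the identity
  (the empty word) is \<open>0\<close>.\<close>

definition inv_letter :: "'a \<times> bool \<Rightarrow> 'a \<times> bool" where
  "inv_letter l = (fst l, \<not> snd l)"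

definition reduced :: "('a \<times> bool) list \<Rightarrow> bool" where
  "reduced w \<longleftrightarrow> successively (\<lambda>l m. m \<noteq> inv_letter l) w"

definition push :: "'a \<times> bool \<Rightarrow> ('a \<times> bool) list \<Rightarrow> ('a \<times> bool) list" where
  "push l w = (if w \<noteq> [] \<and> hd w = inv_letter l then tl w else l # w)"

definition reduce :: "('a \<times> bool) list \<Rightarrow> ('a \<times> bool) list" where
  "reduce w = foldr push w []"

lemma inv_letter_inv [simp]: "inv_letter (inv_letter l) = l"
  by (simp add: inv_letter_def)

lemma reduced_Nil [simp]: "reduced []"
  by (simp add: reduced_def)

lemma reduced_Cons: "reduced (l # w) \<longleftrightarrow> reduced w \<and> (w = [] \<or> hd w \<noteq> inv_letter l)"
  by (cases w) (auto simp: reduced_def)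

lemma reduced_push: "reduced w \<Longrightarrow> reduced (push l w)"
  by (cases w) (auto simp: push_def reduced_Cons)

lemma push_push_inv: "reduced w \<Longrightarrow> push l (push (inv_letter l) w) = w"
  by (cases w) (auto simp: push_def reduced_Cons)

lemma reduced_foldr: "reduced v \<Longrightarrow> reduced (foldr push u v)"
  by (induction u) (auto simp: reduced_push)

lemma reduced_reduce [simp]: "reduced (reduce w)"
  by (simp add: reduce_def reduced_foldr)

lemma reduce_reduced: "reduced w \<Longrightarrow> reduce w = w"
  by (induction w) (auto simp: reduce_def reduced_Cons push_def)

lemma foldr_push_push:
  assumes v: "reduced v"
  shows "foldr push (push l u) v = push l (foldr push u v)"
proof (cases "u \<noteq> [] \<and> hd u = inv_letter l")
  case True
  then obtain u' where u: "u = inv_letter l # u'" by (cases u) auto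
  have "push l (foldr push u v) = foldr push u' v"
    unfolding u using push_push_inv[OF reduced_foldr[OF v]] by simp
  moreover have "push l u = u'" by (simp add: u push_def)
  ultimately show ?thesis by simp
next
  case False
  then have "push l u = l # u" unfolding push_def by (rule if_not_P)
  then show ?thesis by simp
qed

lemma foldr_push_reduce: "reduced v \<Longrightarrow> foldr push (reduce u) v = foldr push u v"
  by (induction u) (auto simp: reduce_def foldr_push_push)

lemma reduce_append: "reduce (u @ v) = foldr push u (reduce v)"
  by (simp add: reduce_def)

lemma reduce_reduce_left: "reduce (reduce u @ v) = reduce (u @ v)"
  by (simp add: reduce_append foldr_push_reduce)

lemma reduce_reduce_right: "reduce (u @ reduce v) = reduce (u @ v)"
  by (simp add: reduce_append reduce_reduced)

definition inv_letters :: "('a \<times> bool) list \<Rightarrow> ('a \<times> bool) list" where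
  "inv_letters w = map inv_letter (rev w)"

lemma inv_letters_cancel: "reduce (inv_letters w @ w) = []"
proof (induction w)
  case (Cons l w)
  have "reduce (inv_letters (l # w) @ l # w)
      = foldr push (inv_letters w) (push (inv_letter l) (push l (reduce w)))"
    by (simp add: inv_letters_def reduce_def)
  also have "push (inv_letter l) (push l (reduce w)) = reduce w"
    using push_push_inv[of "reduce w" "inv_letter l"] by simp
  finally show ?case using Cons by (simp add: reduce_append)
qed (simp add: inv_letters_def reduce_def)

typedef 'a free_group = "{w :: ('a \<times> bool) list. reduced w}"
  morphisms letters_of Abs_free_group
  by (rule exI[of _ "[]"]) simp

setup_lifting type_definition_free_group

instantiation free_group :: (type) group_add
begin

lift_definition zero_free_group :: "'a free_group" is "[]" by simp

lift_definition plus_free_group :: "'a free_group \<Rightarrow> 'a free_group \<Rightarrow> 'a free_group"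
  is "\<lambda>u v. reduce (u @ v)" by simp

lift_definition uminus_free_group :: "'a free_group \<Rightarrow> 'a free_group"
  is "\<lambda>u. reduce (inv_letters u)" by simp

definition minus_free_group :: "'a free_group \<Rightarrow> 'a free_group \<Rightarrow> 'a free_group" where
  "minus_free_group g h = g + - h"

instance
proof
  fix a b c :: "'a free_group"
  show "a + b + c = a + (b + c)"
    by transfer (simp add: reduce_reduce_left reduce_reduce_right)
  show "0 + a = a" by transfer (simp add: reduce_reduced)
  show "a + 0 = a" by transfer (simp add: reduce_reduced)
  show "- a + a = 0" by transfer (simp add: reduce_reduce_left inv_letters_cancel)
  show "a + - b = a - b" by (simp add: minus_free_group_def)
qed

end

lemma reduced_map_Pair: "reduced (map (\<lambda>a. (a, b)) w)"
  by (induction w) (auto simp: reduced_Cons inv_letter_def hd_map)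

lift_definition word :: "'a list \<Rightarrow> 'a free_group" is "map (\<lambda>a. (a, True))"
  by (rule reduced_map_Pair)

text \<open>\<open>reduced_pair \<alpha> \<beta>\<close>: no cancellation occurs in \<open>\<alpha> \<beta>\<inverse>\<close>.\<close>

definition reduced_pair :: "'a list \<Rightarrow> 'a list \<Rightarrow> bool" where
  "reduced_pair \<alpha> \<beta> \<longleftrightarrow> \<alpha> = [] \<or> \<beta> = [] \<or> last \<alpha> \<noteq> last \<beta>"

definition has_reduced_form :: "'a free_group \<Rightarrow> 'a list \<Rightarrow> 'a list \<Rightarrow> bool" where
  "has_reduced_form g \<alpha> \<beta> \<longleftrightarrow> g = word \<alpha> - word \<beta> \<and> reduced_pair \<alpha> \<beta>"

lemma reduced_appendI:
  "reduced u \<Longrightarrow> reduced v \<Longrightarrow> u = [] \<or> v = [] \<or> hd v \<noteq> inv_letter (last u) \<Longrightarrow> reduced (u @ v)"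
  by (auto simp: reduced_def successively_append_iff)

lemma letters_of_has_reduced_form:
  assumes "has_reduced_form g \<alpha> \<beta>"
  shows "letters_of g = map (\<lambda>a. (a, True)) \<alpha> @ map (\<lambda>a. (a, False)) (rev \<beta>)"
proof -
  have inv: "inv_letters (map (\<lambda>a. (a, True)) \<beta>) = map (\<lambda>a. (a, False)) (rev \<beta>)"
    by (simp add: inv_letters_def inv_letter_def rev_map)
  have "reduced (map (\<lambda>a. (a, True)) \<alpha> @ map (\<lambda>a. (a, False)) (rev \<beta>))"
    using assms
    by (intro reduced_appendI reduced_map_Pair)
      (auto simp: has_reduced_form_def reduced_pair_def inv_letter_def last_map hd_map hd_rev)
  then have "letters_of (word \<alpha> - word \<beta>)
      = map (\<lambda>a. (a, True)) \<alpha> @ map (\<lambda>a. (a, False)) (rev \<beta>)"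
    by (simp add: minus_free_group_def plus_free_group.rep_eq uminus_free_group.rep_eq word.rep_eq
        reduce_reduce_right inv reduce_reduced del: add_uminus_conv_diff)
  with assms show ?thesis by (simp add: has_reduced_form_def)
qed

lemma has_reduced_form_unique:
  assumes "has_reduced_form g \<alpha> \<beta>" "has_reduced_form g \<alpha>' \<beta>'"
  shows "\<alpha> = \<alpha>' \<and> \<beta> = \<beta>'"
proof -
  have *: "map fst (filter snd (map (\<lambda>a. (a, True)) u @ map (\<lambda>a. (a, False)) v)) = u"
    "map fst (filter (\<lambda>l. \<not> snd l) (map (\<lambda>a. (a, True)) u @ map (\<lambda>a. (a, False)) v)) = v"
    for u v :: "'a list"
    by (simp_all add: filter_map comp_def)
  show ?thesis
    using letters_of_has_reduced_form[OF assms(1)] letters_of_has_reduced_form[OF assms(2)]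
      *[of \<alpha> "rev \<beta>"] *[of \<alpha>' "rev \<beta>'"] by (metis rev_is_rev_conv)
qed


section \<open>The subshift algebra\<close>

text \<open>The free unital \<open>R\<close>-algebra on \<open>G\<close> is the monoid algebra of the free monoid on \<open>G\<close>. The
  product of \<open>'m \<Rightarrow>\<^sub>0 'r\<close> is convolution with respect to \<open>+\<close> on \<open>'m\<close>, so the free monoid (lists
  under concatenation) has to be written additively. The scalar \<open>\<lambda>\<close> of the algebra is
  \<open>Poly_Mapping.single 0 \<lambda>\<close>, which is central; two-sided ring ideals are therefore algebra
  ideals, and the ring quotient is the quotient algebra.\<close>

datatype 'g free_monoid = Mon (gens_of: "'g list")

instantiation free_monoid :: (type) monoid_add
begin

definition zero_free_monoid :: "'a free_monoid" where
  "0 = Mon []"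

definition plus_free_monoid :: "'a free_monoid \<Rightarrow> 'a free_monoid \<Rightarrow> 'a free_monoid" where
  "u + v = Mon (gens_of u @ gens_of v)"

instance
  by standard (auto simp: zero_free_monoid_def plus_free_monoid_def)

end

abbreviation scalar :: "'r::comm_ring_1 \<Rightarrow> ('g free_monoid \<Rightarrow>\<^sub>0 'r)" where
  "scalar r \<equiv> Poly_Mapping.single 0 r"

definition gen :: "'g \<Rightarrow> ('g free_monoid \<Rightarrow>\<^sub>0 'r::comm_ring_1)" where
  "gen g = Poly_Mapping.single (Mon [g]) 1"

definition free_algebra :: "'g set \<Rightarrow> ('g free_monoid \<Rightarrow>\<^sub>0 'r::comm_ring_1) ring" where
  "free_algebra G =
     \<lparr>carrier = {f. \<forall>m \<in> Poly_Mapping.keys f. set (gens_of m) \<subseteq> G},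
      mult = (*), one = 1, zero = 0, add = (+)\<rparr>"

lemma ring_free_algebra: "ring (free_algebra G :: ('g free_monoid \<Rightarrow>\<^sub>0 'r::comm_ring_1) ring)"
proof -
  let ?K = "{f :: 'g free_monoid \<Rightarrow>\<^sub>0 'r. \<forall>m \<in> Poly_Mapping.keys f. set (gens_of m) \<subseteq> G}"
  have add: "f + g \<in> ?K" if "f \<in> ?K" "g \<in> ?K" for f g
    using that keys_add[of f g] by blast
  have mult: "f * g \<in> ?K" if "f \<in> ?K" "g \<in> ?K" for f g
    using that keys_mult[of f g] by (fastforce simp: plus_free_monoid_def)
  have inv: "\<exists>g\<in>?K. g + f = 0" if "f \<in> ?K" for f
    using that by (intro bexI[of _ "- f"]) auto
  have zero: "0 \<in> ?K" and one: "1 \<in> ?K" by (auto simp: zero_free_monoid_def)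
  let ?F = "\<lparr>carrier = ?K, mult = (*), one = 1, zero = 0, add = (+)\<rparr>"
  have "abelian_group ?F"
    by (rule abelian_groupI; (unfold ring_record_simps partial_object.simps)?)
      (rule add zero inv add.assoc add.commute add_0_left; assumption?)+
  moreover have "monoid ?F"
    by (rule monoidI; (unfold monoid.simps partial_object.simps)?)
      (rule mult one mult.assoc mult_1_left mult_1_right; assumption?)+
  ultimately have "ring ?F"
    by (rule ringI; (unfold ring_record_simps)?) (rule distrib_right distrib_left)+
  then show ?thesis unfolding free_algebra_def .
qed

text \<open>The Boolean algebra of subsets of \<open>X\<close> generated by the sets \<open>C(\<alpha>, \<beta>)\<close>.\<close>

inductive_set boolean_algebra_of :: "(nat \<Rightarrow> 'a) set \<Rightarrow> (nat \<Rightarrow> 'a) set set"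
  for X :: "(nat \<Rightarrow> 'a) set" where
  cyl: "\<alpha> \<in> lang X \<Longrightarrow> \<beta> \<in> lang X \<Longrightarrow> cyl X \<alpha> \<beta> \<in> boolean_algebra_of X"
| empty: "{} \<in> boolean_algebra_of X"
| compl: "A \<in> boolean_algebra_of X \<Longrightarrow> X - A \<in> boolean_algebra_of X"
| union: "A \<in> boolean_algebra_of X \<Longrightarrow> B \<in> boolean_algebra_of X \<Longrightarrow> A \<union> B \<in> boolean_algebra_of X"
| inter: "A \<in> boolean_algebra_of X \<Longrightarrow> B \<in> boolean_algebra_of X \<Longrightarrow> A \<inter> B \<in> boolean_algebra_of X"

datatype 'a generator = P "(nat \<Rightarrow> 'a) set" | S 'a | Sstar 'a

definition generators :: "(nat \<Rightarrow> 'a) set \<Rightarrow> 'a generator set" where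
  "generators X = P ` boolean_algebra_of X \<union> range S \<union> range Sstar"

type_synonym ('a, 'r) free_alg = "'a generator free_monoid \<Rightarrow>\<^sub>0 'r"

definition s_word :: "'a list \<Rightarrow> ('a, 'r::comm_ring_1) free_alg" where
  "s_word \<alpha> = prod_list (map (\<lambda>a. gen (S a)) \<alpha>)"

definition sstar_word :: "'a list \<Rightarrow> ('a, 'r::comm_ring_1) free_alg" where
  "sstar_word \<alpha> = prod_list (map (\<lambda>a. gen (Sstar a)) (rev \<alpha>))"

text \<open>The relations, as differences of their two sides.\<close>

definition relators :: "(nat \<Rightarrow> 'a) set \<Rightarrow> ('a, 'r::comm_ring_1) free_alg set" where
  "relators X =
     {gen (P X) - 1, gen (P {})}
     \<union> {gen (P (A \<inter> B)) - gen (P A) * gen (P B)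
        |A B. A \<in> boolean_algebra_of X \<and> B \<in> boolean_algebra_of X}
     \<union> {gen (P (A \<union> B)) - (gen (P A) + gen (P B) - gen (P (A \<inter> B)))
        |A B. A \<in> boolean_algebra_of X \<and> B \<in> boolean_algebra_of X}
     \<union> {gen (S a) * gen (Sstar a) * gen (S a) - gen (S a) |a. True}
     \<union> {gen (Sstar a) * gen (S a) * gen (Sstar a) - gen (Sstar a) |a. True}
     \<union> {s_word \<beta> * sstar_word \<alpha> * s_word \<alpha> * sstar_word \<beta> - gen (P (cyl X \<alpha> \<beta>))
        |\<alpha> \<beta>. \<alpha> \<in> lang X \<and> \<beta> \<in> lang X}"

definition relation_ideal :: "(nat \<Rightarrow> 'a) set \<Rightarrow> ('a, 'r::comm_ring_1) free_alg set" where
  "relation_ideal X = Idl\<^bsub>free_algebra (generators X)\<^esub> (relators X)"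

definition subshift_algebra :: "(nat \<Rightarrow> 'a) set \<Rightarrow> ('a, 'r::comm_ring_1) free_alg set ring" where
  "subshift_algebra X = free_algebra (generators X) Quot relation_ideal X"

text \<open>The image in the subshift algebra of an element of the free algebra.\<close>

definition cls :: "(nat \<Rightarrow> 'a) set \<Rightarrow> ('a, 'r::comm_ring_1) free_alg \<Rightarrow> ('a, 'r) free_alg set" where
  "cls X f = relation_ideal X +>\<^bsub>free_algebra (generators X)\<^esub> f"

lemma gen_in_free_algebra: "g \<in> G \<Longrightarrow> gen g \<in> carrier (free_algebra G)"
  by (auto simp: free_algebra_def gen_def)

lemma prod_list_in_free_algebra:
  assumes "\<And>f. f \<in> set fs \<Longrightarrow> f \<in> carrier (free_algebra G)"
  shows "prod_list fs \<in> carrier (free_algebra G)"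
  using assms
proof (induction fs)
  case Nil
  show ?case by (simp add: free_algebra_def zero_free_monoid_def)
next
  case (Cons f fs)
  interpret ring "free_algebra G" by (rule ring_free_algebra)
  have "f \<otimes>\<^bsub>free_algebra G\<^esub> prod_list fs \<in> carrier (free_algebra G)"
    using Cons by (intro m_closed) auto
  then show ?case by (simp add: free_algebra_def)
qed

lemma word_in_free_algebra:
  "s_word \<alpha> \<in> carrier (free_algebra (generators X))"
  "sstar_word \<alpha> \<in> carrier (free_algebra (generators X))"
  unfolding s_word_def sstar_word_def
  by (rule prod_list_in_free_algebra; auto intro!: gen_in_free_algebra simp: generators_def)+

lemma space_in_boolean_algebra: "X \<in> boolean_algebra_of X"
  using boolean_algebra_of.compl[OF boolean_algebra_of.empty, of X] by simp

lemma relators_in_free_algebra: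
  "(relators X :: ('a, 'r::comm_ring_1) free_alg set) \<subseteq> carrier (free_algebra (generators X))"
proof -
  let ?F = "free_algebra (generators X) :: ('a, 'r) free_alg ring"
  interpret ring ?F by (rule ring_free_algebra)
  have add: "f + g \<in> carrier ?F" and mult: "f * g \<in> carrier ?F"
    if "f \<in> carrier ?F" "g \<in> carrier ?F" for f g
    using a_closed[OF that] m_closed[OF that] by (simp_all add: free_algebra_def)
  have neg: "- f \<in> carrier ?F" if "f \<in> carrier ?F" for f
    using that by (simp add: free_algebra_def)
  have diff: "f - g \<in> carrier ?F" if "f \<in> carrier ?F" "g \<in> carrier ?F" for f g
    using add[OF that(1) neg[OF that(2)]] by simp
  have one: "1 \<in> carrier ?F" using one_closed by (simp add: free_algebra_def)
  have gens: "gen (P A) \<in> carrier ?F" if "A \<in> boolean_algebra_of X" for A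
    using that by (intro gen_in_free_algebra) (auto simp: generators_def)
  have S: "gen (S a) \<in> carrier ?F" "gen (Sstar a) \<in> carrier ?F" for a
    by (intro gen_in_free_algebra; simp add: generators_def)+
  show ?thesis
    unfolding relators_def
    by (auto intro!: diff add mult gens S one word_in_free_algebra boolean_algebra_of.intros
        space_in_boolean_algebra)
qed

lemma ideal_relation_ideal: "ideal (relation_ideal X) (free_algebra (generators X))"
  unfolding relation_ideal_def
  by (rule ring.genideal_ideal[OF ring_free_algebra relators_in_free_algebra])

lemma ring_subshift_algebra: "ring (subshift_algebra X)"
  unfolding subshift_algebra_def
  by (rule ideal.quotient_is_ring[OF ideal_relation_ideal])

definition group_rep ::
  "(nat \<Rightarrow> 'a) set \<Rightarrow> 'a free_group \<Rightarrow> ('a, 'r::comm_ring_1) free_alg set" where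
  "group_rep X g =
     (if \<exists>\<alpha>\<in>lang X. \<exists>\<beta>\<in>lang X. has_reduced_form g \<alpha> \<beta>
      then THE z. \<exists>\<alpha>\<in>lang X. \<exists>\<beta>\<in>lang X. has_reduced_form g \<alpha> \<beta> \<and>
                    z = cls X (s_word \<alpha> * sstar_word \<beta>)
      else \<zero>\<^bsub>subshift_algebra X\<^esub>)"

lemma group_rep_eq:
  assumes "\<alpha> \<in> lang X" "\<beta> \<in> lang X" "has_reduced_form g \<alpha> \<beta>"
  shows "group_rep X g = cls X (s_word \<alpha> * sstar_word \<beta>)"
proof -
  have "\<exists>\<alpha>\<in>lang X. \<exists>\<beta>\<in>lang X. has_reduced_form g \<alpha> \<beta>" using assms by blast
  moreover have "(THE z. \<exists>\<alpha>\<in>lang X. \<exists>\<beta>\<in>lang X. has_reduced_form g \<alpha> \<beta> \<and>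
      z = cls X (s_word \<alpha> * sstar_word \<beta>)) = cls X (s_word \<alpha> * sstar_word \<beta>)"
    using assms by (intro the_equality) (auto dest: has_reduced_form_unique)
  ultimately show ?thesis by (simp add: group_rep_def)
qed


section \<open>The spectrum and its partial action\<close>

text \<open>A formal expression \<open>\<Sum>\<^sub>i \<lambda>\<^sub>i \<Prod>\<^sub>j \<epsilon>(g\<^sub>i\<^sub>j)\<close> is the list of the pairs of \<open>\<lambda>\<^sub>i\<close> and the list of the
  \<open>g\<^sub>i\<^sub>j\<close>.\<close>

type_synonym ('a, 'r) formal = "('r \<times> 'a free_group list) list"

text \<open>In the first kind of relation the pairs \<open>(\<beta>\<^sub>i\<^sub>j, \<gamma>\<^sub>i\<^sub>j)\<close> give group elements \<open>\<beta>\<^sub>i\<^sub>j \<gamma>\<^sub>i\<^sub>j\<inverse>\<close> in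
  reduced form. This is needed for \<open>p(C(\<gamma>, \<beta>))\<close> to depend only on \<open>\<beta> \<gamma>\<inverse>\<close>: it equals
  \<open>\<pi>(g) \<pi>(g\<inverse>)\<close> for \<open>g = \<beta> \<gamma>\<inverse>\<close> in reduced form. Without it, distinct letters \<open>a\<close>, \<open>b\<close> of \<open>X\<close>
  would give \<open>p(C(a, a)) p(C(b, b)) = 0\<close> and thus the relation \<open>\<epsilon>(1) \<epsilon>(1) = 0\<close>.\<close>

definition relations :: "(nat \<Rightarrow> 'a) set \<Rightarrow> ('a, 'r::comm_ring_1) formal set" where
  "relations X =
     {map (\<lambda>(r, bs). (r, map (\<lambda>(\<beta>, \<gamma>). word \<beta> - word \<gamma>) bs)) t |t.
        (\<forall>(r, bs) \<in> set t. \<forall>(\<beta>, \<gamma>) \<in> set bs.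
            \<beta> \<in> lang X \<and> \<gamma> \<in> lang X \<and> reduced_pair \<beta> \<gamma>) \<and>
        cls X (\<Sum>(r, bs) \<leftarrow> t. scalar r * (\<Prod>(\<beta>, \<gamma>) \<leftarrow> bs. gen (P (cyl X \<gamma> \<beta>))))
          = \<zero>\<^bsub>subshift_algebra X\<^esub>}
     \<union> {[(1, [g])] |g. (group_rep X g :: ('a, 'r) free_alg set) = \<zero>\<^bsub>subshift_algebra X\<^esub>}"

definition eval_formal :: "('a, 'r::comm_ring_1) formal \<Rightarrow> 'a free_group set \<Rightarrow> 'r" where
  "eval_formal f \<xi> = (\<Sum>(r, gs) \<leftarrow> f. r * (\<Prod>g \<leftarrow> gs. if g \<in> \<xi> then 1 else 0))"

definition Theta :: "(nat \<Rightarrow> 'a) set \<Rightarrow> ('a free_group set \<Rightarrow> 'r::comm_ring_1) set" where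
  "Theta X = eval_formal ` relations X"

text \<open>\<open>X\<^sub>F\<close>: subsets of the free group containing the identity, with the topology of \<open>{0,1}\<^sup>F\<close> pulled
  back along \<open>\<xi> \<mapsto> (g \<mapsto> g \<in> \<xi>)\<close>.\<close>

definition power_space :: "'a free_group set topology" where
  "power_space =
     pullback_topology {\<xi>. 0 \<in> \<xi>} (\<lambda>\<xi> g. g \<in> \<xi>) (product_topology (\<lambda>_. discrete_topology UNIV) UNIV)"

definition Omega :: "'r::comm_ring_1 itself \<Rightarrow> (nat \<Rightarrow> 'a) set \<Rightarrow> 'a free_group set set" where
  "Omega R X =
     {\<xi>. 0 \<in> \<xi> \<and> (\<forall>f \<in> (Theta X :: ('a free_group set \<Rightarrow> 'r) set). \<forall>g\<in>\<xi>. f ((+) (- g) ` \<xi>) = 0)}"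

definition Omega_space :: "'r::comm_ring_1 itself \<Rightarrow> (nat \<Rightarrow> 'a) set \<Rightarrow> 'a free_group set topology" where
  "Omega_space R X = subtopology power_space (Omega R X)"

definition Omega_at ::
  "'r::comm_ring_1 itself \<Rightarrow> (nat \<Rightarrow> 'a) set \<Rightarrow> 'a free_group \<Rightarrow> 'a free_group set set" where
  "Omega_at R X g = {\<xi> \<in> Omega R X. g \<in> \<xi>}"

definition theta :: "'a free_group \<Rightarrow> 'a free_group set \<Rightarrow> 'a free_group set" where
  "theta g \<xi> = (+) g ` \<xi>"

lemma topspace_Omega_space: "topspace (Omega_space R X) = Omega R X"
  by (auto simp: Omega_space_def power_space_def topspace_pullback_topology Omega_def)

lemma theta_maps:
  fixes R :: "'r::comm_ring_1 itself"
  shows "theta g ` Omega_at R X (- g) = Omega_at R X g"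
proof -
  have sub: "theta g ` Omega_at R X (- g) \<subseteq> Omega_at R X g" for g
  proof (rule image_subsetI)
    fix \<xi> assume "\<xi> \<in> Omega_at R X (- g)"
    then have mem: "- g \<in> \<xi>" "0 \<in> \<xi>"
      and rel: "\<And>f k. f \<in> (Theta X :: (_ \<Rightarrow> 'r) set) \<Longrightarrow> k \<in> \<xi> \<Longrightarrow> f ((+) (- k) ` \<xi>) = 0"
      by (auto simp: Omega_at_def Omega_def)
    have "(+) (- (g + k)) ` (+) g ` \<xi> = (+) (- k) ` \<xi>" for k
      by (simp only: image_image minus_add add.assoc minus_add_cancel)
    then have "f ((+) (- h) ` (+) g ` \<xi>) = 0"
      if "f \<in> (Theta X :: (_ \<Rightarrow> 'r) set)" "h \<in> (+) g ` \<xi>" for f h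
      using that rel by auto
    moreover have "0 \<in> (+) g ` \<xi>" using mem(1) by (force simp: image_iff)
    moreover have "g \<in> (+) g ` \<xi>" using mem(2) by (force simp: image_iff)
    ultimately show "theta g \<xi> \<in> Omega_at R X g"
      by (auto simp: Omega_at_def Omega_def theta_def)
  qed
  have inv: "theta g (theta (- g) \<xi>) = \<xi>" for \<xi> by (auto simp: theta_def image_image)
  show ?thesis
  proof (intro equalityI subsetI)
    fix \<xi> assume "\<xi> \<in> Omega_at R X g"
    then have "theta (- g) \<xi> \<in> Omega_at R X (- g)" using sub[of "- g"] by auto
    then show "\<xi> \<in> theta g ` Omega_at R X (- g)" by (metis inv imageI)
  qed (use sub in blast)
qed

definition orbit :: "'r::comm_ring_1 itself \<Rightarrow> (nat \<Rightarrow> 'a) set \<Rightarrow> 'a free_group set \<Rightarrow> 'a free_group set set" where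
  "orbit R X \<xi> = {theta g \<xi> |g. \<xi> \<in> Omega_at R X (- g)}"

definition minimal_theta :: "'r::comm_ring_1 itself \<Rightarrow> (nat \<Rightarrow> 'a) set \<Rightarrow> bool" where
  "minimal_theta R X \<longleftrightarrow>
     (\<forall>\<xi> \<in> Omega R X. Omega_space R X closure_of orbit R X \<xi> = Omega R X)"

end

theory Submission
  imports Defs
begin

text \<open>A point \<open>x\<close> of \<open>X\<close> gives the set \<open>config X x\<close> of the group elements \<open>b c\<inverse>\<close> with \<open>x = b z\<close> and
  \<open>c z \<in> X\<close>. The spectrum is the closure of these sets in \<open>{0,1}\<^sup>F\<close>: if a point of the spectrum
  differed on a finite set from all of them, the corresponding product of idempotents \<open>p\<close> and
  \<open>1 - p\<close> would be \<open>p(\<emptyset>) = 0\<close>, a relation violated at that point; conversely, the relations hold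
  at \<open>config X x\<close> because the algebra acts on the \<open>R\<close>-valued functions supported in \<open>X\<close>.

  Minimality, compact cofinality and (if the alphabet is countable) sequential cofinality are all
  equivalent to: for every finite \<open>B\<close> with nonempty
  \<open>F\<^sub>B\<close>, finitely many pairs \<open>(\<alpha>, \<gamma>)\<close> suffice to cover \<open>X\<close> by the sets \<open>\<Inter>\<beta>\<in>B. C(\<beta>\<gamma>, \<alpha>)\<close>. From
  minimality this follows by compactness of the spectrum, since translating by some \<open>k\<inverse>\<close>, \<open>k = \<alpha> \<gamma>\<inverse>\<close>, one
  reaches the open set of the \<open>\<xi>\<close> that contain all \<open>\<beta>\<inverse>\<close>. Conversely, a basic neighbourhood of
  \<open>config X x\<close> contains \<open>config X (b z)\<close> for every \<open>z\<close> with \<open>B z \<subseteq> X\<close>, where \<open>b \<in> B\<close> is a long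
  prefix of \<open>x\<close> and \<open>B\<close> is a suitable finite set with \<open>F\<^sub>B \<noteq> \<emptyset>\<close>.\<close>

section \<open>Quotients of words and the configuration of a point\<close>

lemma word_append: "word (u @ v) = word u + word v"
  by transfer (simp add: reduce_reduced reduced_map_Pair flip: map_append)

lemma word_Nil: "word [] = 0"
  by transfer simp

lemma word_cancel_suffix: "word (u @ w) - word (v @ w) = word u - word v"
  by (simp add: word_append diff_conv_add_uminus minus_add add.assoc del: add_uminus_conv_diff)

lemma conc_eq_conc_cases:
  assumes "u \<frown> x = v \<frown> y"
  obtains w where "u = v @ w" "y = w \<frown> x" | w where "v = u @ w" "x = w \<frown> y"
proof -
  have *: "\<exists>w. v = u @ w \<and> x = w \<frown> y" if le: "length u \<le> length v" and eq: "u \<frown> x = v \<frown> y"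
    for u v :: "'a list" and x y
  proof (intro exI conjI)
    have nth: "(u \<frown> x) n = (v \<frown> y) n" for n by (simp add: eq)
    have "u = take (length u) v"
      using le nth by (intro nth_equalityI) (auto simp: conc_def, metis order.strict_trans2)
    then show v: "v = u @ drop (length u) v" by (metis append_take_drop_id)
    show "x = drop (length u) v \<frown> y"
    proof
      fix n
      show "x n = (drop (length u) v \<frown> y) n"
        using nth[of "length u + n"] le by (auto simp: conc_def less_diff_conv add.commute)
    qed
  qed
  show thesis
    using *[of u v x y] *[of v u y x] assms that by (metis nle_le)
qed

text \<open>No reducedness is asked of \<open>b\<close> and \<open>c\<close>, so a representation
  may be lengthened by letters of \<open>z\<close>. The reduced one is recovered in
  \<open>config_reduced_form\<close>.\<close>

definition config :: "(nat \<Rightarrow> 'a) set \<Rightarrow> (nat \<Rightarrow> 'a) \<Rightarrow> 'a free_group set" where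
  "config X x = {word b - word c |b c. \<exists>z. x = b \<frown> z \<and> c \<frown> z \<in> X}"

lemma in_configI: "x = b \<frown> z \<Longrightarrow> c \<frown> z \<in> X \<Longrightarrow> word b - word c \<in> config X x"
  by (auto simp: config_def)

lemma zero_in_config: "x \<in> X \<Longrightarrow> 0 \<in> config X x"
  using in_configI[of x "[]" x "[]" X] by simp

text \<open>Of the two prefixes \<open>c\<close> and \<open>p\<close> of \<open>c \<frown> z\<close>
  one extends the other. So the middle of the product cancels and a quotient of two positive words
  remains.\<close>

lemma config_translate:
  assumes "b \<frown> z \<in> X" "g \<in> config X (c \<frown> z)"
  shows "word b - word c + g \<in> config X (b \<frown> z)"
proof -
  obtain p q y where g: "g = word p - word q" and y: "c \<frown> z = p \<frown> y" "q \<frown> y \<in> X"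
    using assms(2) by (auto simp: config_def)
  from y(1) show ?thesis
  proof (cases rule: conc_eq_conc_cases)
    case (1 w)
    then have "word b - word c + g = word b - word (q @ w)"
      by (simp add: g word_append diff_conv_add_uminus minus_add add.assoc del: add_uminus_conv_diff)
    then show ?thesis using y(2) 1 by (auto intro: in_configI)
  next
    case (2 w)
    then have "word b - word c + g = word (b @ w) - word q"
      by (simp add: g word_append diff_conv_add_uminus add.assoc del: add_uminus_conv_diff)
    then show ?thesis using y(2) 2 by (metis in_configI conc_conc)
  qed
qed

text \<open>The two directions are translations by mutually inverse elements. In effect, the partial
  action carries the configuration of \<open>c \<frown> z\<close> to that of
  \<open>b \<frown> z\<close>.\<close>

lemma config_shift:
  assumes "b \<frown> z \<in> X" "c \<frown> z \<in> X"
  shows "word b - word c + g \<in> config X (b \<frown> z) \<longleftrightarrow> g \<in> config X (c \<frown> z)"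
proof
  assume "word b - word c + g \<in> config X (b \<frown> z)"
  from config_translate[OF assms(2) this]
  show "g \<in> config X (c \<frown> z)"
    by (simp add: diff_conv_add_uminus add.assoc del: add_uminus_conv_diff)
qed (rule config_translate[OF assms(1)])

lemma ex_reduced_form: "\<exists>p q w. b = p @ w \<and> c = q @ w \<and> reduced_pair p q"
proof (induction b arbitrary: c rule: rev_induct)
  case Nil
  show ?case by (simp add: reduced_pair_def)
next
  case (snoc a b)
  show ?case
  proof (cases "c \<noteq> [] \<and> last c = a")
    case True
    then obtain c' where c: "c = c' @ [a]" by (metis append_butlast_last_id)
    obtain p q w where "b = p @ w" "c' = q @ w" "reduced_pair p q" using snoc by blast
    then show ?thesis
      by (intro exI[of _ p] exI[of _ q] exI[of _ "w @ [a]"]) (simp add: c)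
  next
    case False
    then show ?thesis
      by (intro exI[of _ "b @ [a]"] exI[of _ c] exI[of _ "[]"]) (auto simp: reduced_pair_def)
  qed
qed

text \<open>The common suffix cancelled from the two words moves to the front of the tail, so the
  shortened pair still describes \<open>x\<close>.\<close>

lemma config_reduced_form:
  assumes "x \<in> X" "g \<in> config X x"
  obtains b c where "has_reduced_form g b c" "x \<in> cyl X c b"
proof -
  obtain b c z where g: "g = word b - word c" "x = b \<frown> z" "c \<frown> z \<in> X"
    using assms by (auto simp: config_def)
  obtain p q w where pq: "b = p @ w" "c = q @ w" "reduced_pair p q"
    using ex_reduced_form by blast
  have "x \<in> cyl X q p"
    unfolding cyl_def using g pq assms(1) by (intro CollectI exI[of _ "w \<frown> z"]) simp
  moreover have "has_reduced_form g p q"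
    using g pq by (simp add: has_reduced_form_def word_cancel_suffix)
  ultimately show thesis using that by blast
qed

text \<open>This is the bridge from configurations to the generating sets of the Boolean algebra; it
  rests on the uniqueness of reduced forms.\<close>

lemma in_config_iff_cyl:
  assumes "x \<in> X" "reduced_pair b c"
  shows "word b - word c \<in> config X x \<longleftrightarrow> x \<in> cyl X c b"
proof
  assume "word b - word c \<in> config X x"
  then obtain p q where pq: "has_reduced_form (word b - word c) p q" "x \<in> cyl X q p"
    using config_reduced_form[OF assms(1)] by blast
  moreover have "has_reduced_form (word b - word c) b c"
    using assms by (simp add: has_reduced_form_def)
  ultimately show "x \<in> cyl X c b" by (metis has_reduced_form_unique)
qed (auto simp: cyl_def intro: in_configI)

section \<open>Language, suffixes and closedness of a subshift\<close>

lemma in_lang: "w \<frown> x \<in> X \<Longrightarrow> w \<in> lang X"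
  using cyl_empty_if_not_lang[of w X w] by (force simp: cyl_def)

lemma cyl_subset: "cyl X c b \<subseteq> X"
  by (auto simp: cyl_def)

lemma subshift_suffix:
  assumes "subshift X" "w \<frown> x \<in> X"
  shows "x \<in> X"
proof -
  obtain W where X: "X = {x. \<forall>i j. x [i \<rightarrow> j] \<notin> W}" using assms(1) by (auto simp: subshift_def)
  have "x [i \<rightarrow> j] = (w \<frown> x) [length w + i \<rightarrow> length w + j]" for i j
    by (rule nth_equalityI) (auto simp: subsequence_def conc_def add.assoc)
  then show ?thesis using assms(2) by (simp add: X)
qed

text \<open>A forbidden subword \<open>x [i \<rightarrow> j]\<close> is visible in the first
  \<open>j\<close> letters. Thus subshifts are closed for the product of discrete topologies, over
  any alphabet.\<close>

lemma subshift_closed: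
  assumes "subshift X" "x \<notin> X"
  obtains m where "\<And>y. (\<And>n. n < m \<Longrightarrow> y n = x n) \<Longrightarrow> y \<notin> X"
proof -
  obtain W where X: "X = {x. \<forall>i j. x [i \<rightarrow> j] \<notin> W}" using assms(1) by (auto simp: subshift_def)
  obtain i j where ij: "x [i \<rightarrow> j] \<in> W" using assms(2) by (auto simp: X)
  show thesis
  proof (rule that[of j])
    fix y assume "\<And>n. n < j \<Longrightarrow> y n = x n"
    then have "y [i \<rightarrow> j] = x [i \<rightarrow> j]" by (auto simp: subsequence_def)
    then have "y [i \<rightarrow> j] \<in> W" using ij by simp
    then show "y \<notin> X" unfolding X by blast
  qed
qed

lemma followers_iff: "x \<in> followers X B \<longleftrightarrow> x \<in> X \<and> (\<forall>\<beta>\<in>B. \<beta> \<frown> x \<in> X)"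
  by (auto simp: followers_def follower_def cyl_def)

text \<open>A prefix of \<open>x\<close> witnessing membership of \<open>g\<close> may be lengthened
  at will, and failure of membership shows in a finite prefix because \<open>X\<close> is closed.
  Hence one length \<open>m\<close> serves any finite set of group elements.\<close>

lemma eventually_config_eq:
  assumes X: "subshift X" and x: "x \<in> X"
  shows "\<forall>\<^sub>F m in sequentially.
    (g \<in> config X x \<longrightarrow> (\<exists>c. g = word (prefix m x) - word c \<and> c \<frown> suffix m x \<in> X)) \<and>
    (g \<notin> config X x \<longrightarrow> (\<forall>y\<in>X. prefix m y = prefix m x \<longrightarrow> g \<notin> config X y))"
proof (cases "g \<in> config X x")
  case True
  then obtain b c z where g: "g = word b - word c" "x = b \<frown> z" "c \<frown> z \<in> X"
    by (auto simp: config_def)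
  have "\<exists>c. g = word (prefix m x) - word c \<and> c \<frown> suffix m x \<in> X" if m: "length b \<le> m" for m
  proof -
    \<comment> \<open>The letters completing \<open>b\<close> to the prefix of length
      \<open>m\<close> are appended to \<open>c\<close> as well.\<close>
    let ?w = "prefix (m - length b) z"
    have "prefix m x = b @ ?w"
      using m by (intro nth_equalityI) (auto simp: g subsequence_def conc_def nth_append)
    moreover have "suffix m x = suffix (m - length b) z"
      using m by (auto simp: g suffix_def conc_def)
    moreover have "(c @ ?w) \<frown> suffix (m - length b) z \<in> X"
      using g(3) by (metis conc_conc prefix_suffix)
    ultimately show ?thesis by (metis g(1) word_cancel_suffix)
  qed
  then show ?thesis using True unfolding eventually_sequentially by blast
next
  case False
  \<comment> \<open>If no configuration contains \<open>g\<close>, the claim is immediate; otherwise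
    one of them supplies a reduced form of \<open>g\<close>, which is then used at every
    point.\<close>
  show ?thesis
  proof (cases "\<exists>y\<in>X. g \<in> config X y")
    case True
    then obtain b c where bc: "has_reduced_form g b c"
      by (meson config_reduced_form)
    have conf: "g \<in> config X y \<longleftrightarrow> y \<in> cyl X c b" if "y \<in> X" for y
      using bc in_config_iff_cyl[OF that] by (simp add: has_reduced_form_def)
    have nx: "x \<notin> cyl X c b" using False x conf by blast
    \<comment> \<open>If \<open>x\<close> does not start with \<open>b\<close>, the first
      \<open>length b\<close> letters show this. Otherwise \<open>k\<close> further letters of the
      tail suffice to keep \<open>c\<close> followed by the tail out of \<open>X\<close>.\<close>
    obtain M where M: "\<And>m y. m \<ge> M \<Longrightarrow> prefix m y = prefix m x \<Longrightarrow> y \<notin> cyl X c b"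
    proof (cases "\<exists>z. x = b \<frown> z")
      case True
      then obtain z where z: "x = b \<frown> z" by blast
      with nx x have "c \<frown> z \<notin> X" by (auto simp: cyl_def)
      then obtain k where k: "\<And>y. (\<And>n. n < k \<Longrightarrow> y n = (c \<frown> z) n) \<Longrightarrow> y \<notin> X"
        using subshift_closed[OF X] by blast
      have "y \<notin> cyl X c b" if m: "m \<ge> length b + k" "prefix m y = prefix m x" for m y
      proof
        assume "y \<in> cyl X c b"
        then obtain u where u: "y = b \<frown> u" "c \<frown> u \<in> X" by (auto simp: cyl_def)
        have eq: "y n = x n" if "n < m" for n
          using m(2) that by (auto simp: subsequence_def)
        have "u n = z n" if "n < k" for n
          using eq[of "length b + n"] m(1) that by (simp add: u z)
        then have "(c \<frown> u) n = (c \<frown> z) n" if "n < k" for n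
          using that by (auto simp: conc_def)
        with k u(2) show False by blast
      qed
      then show thesis using that by blast
    next
      case no: False
      have "y \<notin> cyl X c b" if m: "m \<ge> length b" "prefix m y = prefix m x" for m y
      proof
        assume "y \<in> cyl X c b"
        then obtain u where u: "y = b \<frown> u" by (auto simp: cyl_def)
        have eq: "y n = x n" if "n < m" for n
          using m(2) that by (auto simp: subsequence_def)
        have "x n = b ! n" if "n < length b" for n
          using eq[of n] m(1) that by (simp add: u)
        then have "x = b \<frown> suffix (length b) x"
          by (auto simp: conc_def suffix_def fun_eq_iff)
        with no show False by blast
      qed
      then show thesis using that by blast
    qed
    then show ?thesis using False conf unfolding eventually_sequentially by blast
  qed (use False in auto)
qed

text \<open>An element of the monoid algebra is the finite sum of its monomials; the empty sum is a
  monomial with coefficient 0.\<close>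

lemma poly_mapping_single_add_induct [case_names single add]:
  fixes f :: "'m \<Rightarrow>\<^sub>0 'r::comm_monoid_add"
  assumes "\<And>m r. Q (Poly_Mapping.single m r)" and "\<And>f g. Q f \<Longrightarrow> Q g \<Longrightarrow> Q (f + g)"
  shows "Q f"
proof -
  have "f = (\<Sum>m\<in>Poly_Mapping.keys f. Poly_Mapping.single m (Poly_Mapping.lookup f m))"
    by (rule poly_mapping_eqI)
      (simp add: Poly_Mapping.lookup_sum lookup_single when_def in_keys_iff)
  moreover have "Q (\<Sum>m\<in>K. Poly_Mapping.single m (Poly_Mapping.lookup f m))" if "finite K" for K
    using that
  proof (induction K rule: finite_induct)
    case empty
    show ?case using assms(1)[of undefined 0] by simp
  qed (simp add: assms)
  ultimately show ?thesis by (metis finite_keys)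
qed

section \<open>The representation on functions supported in the subshift\<close>

text \<open>The standard representation, dual to removing and adding a first letter. Functions on
  all sequences stand for functions on \<open>X\<close>: the relation between \<open>P X\<close> and
  1 is respected only on those vanishing outside \<open>X\<close>.\<close>

fun act_gen :: "(nat \<Rightarrow> 'a) set \<Rightarrow> 'a generator \<Rightarrow> ((nat \<Rightarrow> 'a) \<Rightarrow> 'r) \<Rightarrow> (nat \<Rightarrow> 'a) \<Rightarrow> 'r::comm_ring_1"
where
  "act_gen X (P A) \<phi> x = (if x \<in> A then \<phi> x else 0)"
| "act_gen X (S a) \<phi> x = (if x \<in> X \<and> x 0 = a then \<phi> (suffix 1 x) else 0)"
| "act_gen X (Sstar a) \<phi> x = (if x \<in> X \<and> [a] \<frown> x \<in> X then \<phi> ([a] \<frown> x) else 0)"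

definition act_word ::
  "(nat \<Rightarrow> 'a) set \<Rightarrow> 'a generator list \<Rightarrow> ((nat \<Rightarrow> 'a) \<Rightarrow> 'r) \<Rightarrow> (nat \<Rightarrow> 'a) \<Rightarrow> 'r::comm_ring_1"
  where "act_word X ws = foldr (act_gen X) ws"

definition act ::
  "(nat \<Rightarrow> 'a) set \<Rightarrow> ('a, 'r) free_alg \<Rightarrow> ((nat \<Rightarrow> 'a) \<Rightarrow> 'r) \<Rightarrow> (nat \<Rightarrow> 'a) \<Rightarrow> 'r::comm_ring_1"
  where "act X f \<phi> x =
    (\<Sum>m\<in>Poly_Mapping.keys f. Poly_Mapping.lookup f m * act_word X (gens_of m) \<phi> x)"

lemma act_gen_add: "act_gen X w (\<lambda>x. \<phi> x + \<psi> x) = (\<lambda>x. act_gen X w \<phi> x + act_gen X w \<psi> x)"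
  by (cases w) auto

lemma act_gen_scale: "act_gen X w (\<lambda>x. r * \<phi> x) = (\<lambda>x. r * act_gen X w \<phi> x)"
  by (cases w) auto

lemma act_word_add:
  "act_word X ws (\<lambda>x. \<phi> x + \<psi> x) = (\<lambda>x. act_word X ws \<phi> x + act_word X ws \<psi> x)"
  by (induction ws) (simp_all add: act_word_def act_gen_add)

lemma act_word_scale: "act_word X ws (\<lambda>x. r * \<phi> x) = (\<lambda>x. r * act_word X ws \<phi> x)"
  by (induction ws) (simp_all add: act_word_def act_gen_scale)

lemma act_superset:
  assumes "finite K" "Poly_Mapping.keys f \<subseteq> K"
  shows "act X f \<phi> x = (\<Sum>m\<in>K. Poly_Mapping.lookup f m * act_word X (gens_of m) \<phi> x)"
  unfolding act_def
  by (rule sum.mono_neutral_left) (use assms in \<open>auto simp: in_keys_iff\<close>)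

lemma act_add: "act X (f + g) \<phi> = (\<lambda>x. act X f \<phi> x + act X g \<phi> x)"
proof
  fix x
  let ?K = "Poly_Mapping.keys f \<union> Poly_Mapping.keys g"
  have "act X h \<phi> x = (\<Sum>m\<in>?K. Poly_Mapping.lookup h m * act_word X (gens_of m) \<phi> x)"
    if "h \<in> {f, g, f + g}" for h
    using that keys_add[of f g] by (intro act_superset) auto
  then show "act X (f + g) \<phi> x = act X f \<phi> x + act X g \<phi> x"
    by (simp add: lookup_add distrib_right sum.distrib)
qed

lemma act_single:
  "act X (Poly_Mapping.single m r) \<phi> = (\<lambda>x. r * act_word X (gens_of m) \<phi> x)"
  by (auto simp: act_def)

lemma act_zero: "act X 0 \<phi> = (\<lambda>x. 0)"
  by (auto simp: act_def)

lemma act_one: "act X 1 \<phi> = \<phi>"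
  by (simp add: act_single act_word_def zero_free_monoid_def flip: single_one)

lemma act_gen: "act X (gen w) \<phi> = act_gen X w \<phi>"
  by (simp add: gen_def act_single act_word_def)

lemma act_diff: "act X (f - g) \<phi> = (\<lambda>x. act X f \<phi> x - act X g \<phi> x)"
proof -
  have "act X f \<phi> = (\<lambda>x. act X (f - g) \<phi> x + act X g \<phi> x)"
    using act_add[of X "f - g" g \<phi>] by simp
  then show ?thesis by simp
qed

text \<open>Both sides are additive in \<open>f\<close> and in \<open>g\<close>. On monomials,
  \<open>foldr\<close> over concatenated words is composition.\<close>

lemma act_mult: "act X (f * g) \<phi> = act X f (act X g \<phi>)"
proof (induction f rule: poly_mapping_single_add_induct)
  case (single m r)
  show ?case
  proof (induction g rule: poly_mapping_single_add_induct)
    case (single n s)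
    show ?case
      by (simp add: mult_single act_single act_word_scale plus_free_monoid_def mult.assoc)
        (simp add: act_word_def)
  next
    case (add f g)
    then show ?case by (simp add: distrib_left act_add act_single act_word_add)
  qed
next
  case (add f g)
  then show ?case by (simp add: distrib_right act_add)
qed

lemma act_scalar: "act X (scalar r) \<phi> = (\<lambda>x. r * \<phi> x)"
  by (simp add: act_single act_word_def zero_free_monoid_def)

lemma boolean_algebra_of_subset: "A \<in> boolean_algebra_of X \<Longrightarrow> A \<subseteq> X"
  by (induction rule: boolean_algebra_of.induct) (auto simp: cyl_def)

text \<open>The first generator of a nonempty word acts last and cuts down to \<open>X\<close>; the
  empty word changes nothing. So the functions supported in \<open>X\<close> form a
  submodule.\<close>

lemma act_outside:
  assumes "f \<in> carrier (free_algebra (generators X))" "\<And>x. x \<notin> X \<Longrightarrow> \<phi> x = 0" "x \<notin> X"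
  shows "act X f \<phi> x = 0"
proof -
  have "act_word X ws \<phi> x = 0" if "set ws \<subseteq> generators X" for ws
  proof (cases ws)
    case Nil
    then show ?thesis using assms by (simp add: act_word_def)
  next
    case (Cons w ws')
    then have "w \<in> generators X" using that by simp
    then have "act_gen X w \<psi> x = 0" for \<psi> :: "_ \<Rightarrow> 'b"
      using assms(3) boolean_algebra_of_subset by (fastforce simp: generators_def)
    then show ?thesis using Cons by (simp add: act_word_def)
  qed
  then show ?thesis
    using assms(1) unfolding act_def by (intro sum.neutral) (auto simp: free_algebra_def)
qed

text \<open>Each letter demands that the lengthened sequence stay in \<open>X\<close>. Only the
  demand for the whole word survives, since \<open>X\<close> contains the suffixes of its
  points.\<close>

lemma act_sstar_word:
  assumes "subshift X" "x \<in> X"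
  shows "act X (sstar_word \<alpha>) \<phi> x = (if \<alpha> \<frown> x \<in> X then \<phi> (\<alpha> \<frown> x) else 0)"
proof (induction \<alpha> arbitrary: \<phi>)
  case Nil
  show ?case using assms by (simp add: sstar_word_def act_one)
next
  case (Cons a \<alpha>)
  have "act X (sstar_word (a # \<alpha>)) \<phi> x = act X (sstar_word \<alpha>) (act_gen X (Sstar a) \<phi>) x"
    by (simp add: sstar_word_def act_mult act_gen)
  also have "\<dots> = (if (a # \<alpha>) \<frown> x \<in> X then \<phi> ((a # \<alpha>) \<frown> x) else 0)"
    using subshift_suffix[OF assms(1), of "[a]" "\<alpha> \<frown> x"] by (auto simp: Cons)
  finally show ?case .
qed

lemma suffix_conc: "suffix (length u) (u \<frown> x) = x"
  by (auto simp: suffix_def)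

lemma act_s_word:
  assumes "subshift X" "\<beta> \<frown> z \<in> X"
  shows "act X (s_word \<beta>) \<phi> (\<beta> \<frown> z) = \<phi> z"
  using assms(2)
proof (induction \<beta>)
  case Nil
  then show ?case by (simp add: s_word_def act_one)
next
  case (Cons b \<beta>)
  have "act X (s_word (b # \<beta>)) \<phi> ((b # \<beta>) \<frown> z)
      = act_gen X (S b) (act X (s_word \<beta>) \<phi>) ([b] \<frown> (\<beta> \<frown> z))"
    by (simp add: s_word_def act_mult act_gen)
  also have "\<dots> = act X (s_word \<beta>) \<phi> (\<beta> \<frown> z)"
    using Cons.prems suffix_conc[of "[b]" "\<beta> \<frown> z"] by simp
  also have "\<dots> = \<phi> z"
    using Cons subshift_suffix[OF assms(1), of "[b]" "\<beta> \<frown> z"] by simp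
  finally show ?case .
qed

lemma act_s_word_eq_0:
  assumes "\<nexists>z. x = \<beta> \<frown> z"
  shows "act X (s_word \<beta>) \<phi> x = 0"
  using assms
proof (induction \<beta> arbitrary: x)
  case Nil
  then show ?case by simp
next
  case (Cons b \<beta>)
  have "act X (s_word \<beta>) \<phi> (suffix 1 x) = 0" if "x 0 = b"
  proof (rule Cons.IH, rule)
    assume "\<exists>z. suffix 1 x = \<beta> \<frown> z"
    then obtain z where "suffix 1 x = \<beta> \<frown> z" by blast
    moreover have "x = [x 0] \<frown> suffix 1 x"
      by (auto simp: conc_def suffix_def)
    ultimately have "x = (b # \<beta>) \<frown> z" using that by (metis append_Cons append_Nil conc_conc)
    with Cons.prems show False by blast
  qed
  then show ?case by (simp add: s_word_def act_mult act_gen)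
qed

text \<open>Evaluation at \<open>\<beta> \<frown> z\<close> leads to \<open>z\<close>, to
  \<open>\<alpha> \<frown> z\<close>, back to \<open>z\<close> and back to
  \<open>\<beta> \<frown> z\<close>; the only obstruction is whether
  \<open>\<alpha> \<frown> z\<close> lies in \<open>X\<close>.\<close>

lemma act_cylinder_relator:
  assumes "subshift X" "x \<in> X"
  shows "act X (s_word \<beta> * sstar_word \<alpha> * s_word \<alpha> * sstar_word \<beta>) \<phi> x
    = (if x \<in> cyl X \<alpha> \<beta> then \<phi> x else 0)"
proof (cases "\<exists>z. x = \<beta> \<frown> z")
  case True
  then obtain z where z: "x = \<beta> \<frown> z" by blast
  have zX: "z \<in> X" using assms z subshift_suffix by blast
  have "x \<in> cyl X \<alpha> \<beta> \<longleftrightarrow> \<alpha> \<frown> z \<in> X"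
    using assms(2) by (auto simp: cyl_def z)
  then show ?thesis
    using assms zX by (simp add: act_mult z act_s_word act_sstar_word)
next
  case False
  then have "x \<notin> cyl X \<alpha> \<beta>" by (auto simp: cyl_def)
  with False show ?thesis by (simp add: act_mult act_s_word_eq_0)
qed

lemma act_relator:
  assumes X: "subshift X" and f: "f \<in> relators X" and \<phi>: "\<And>x. x \<notin> X \<Longrightarrow> \<phi> x = (0 :: 'r::comm_ring_1)"
  shows "act X f \<phi> = (\<lambda>x. 0)"
proof
  fix x
  show "act X f \<phi> x = 0"
  proof (cases "x \<in> X")
    case False
    then show ?thesis using act_outside f \<phi> relators_in_free_algebra by (metis subsetD)
  next
    case True
    have S: "gen (S a) = (s_word [a] :: ('a, 'r) free_alg)"
      and Sstar: "gen (Sstar a) = (sstar_word [a] :: ('a, 'r) free_alg)" for a :: 'a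
      by (simp_all add: s_word_def sstar_word_def)
    have conc_tl: "[x 0] \<frown> suffix 1 x = x"
      by (auto simp: conc_def suffix_def)
    have tl: "suffix 1 x \<in> X"
      using True conc_tl subshift_suffix[OF X, of "[x 0]"] by simp
    have "act X (gen (S a) * gen (Sstar a) * gen (S a) - gen (S a)) \<phi> x = 0" for a
      using True tl conc_tl by (auto simp: act_diff act_mult act_gen)
    moreover have "suffix 1 ([a] \<frown> x) = x" for a
      using suffix_conc[of "[a]" x] by simp
    then have "act X (gen (Sstar a) * gen (S a) * gen (Sstar a) - gen (Sstar a)) \<phi> x = 0" for a
      using True by (auto simp: act_diff act_mult act_gen)
    ultimately show ?thesis
      using f True
      \<comment> \<open>Restricting \<open>act_mult\<close> to products of two generators keeps the
        cylinder relator in the form that \<open>act_cylinder_relator\<close> rewrites.\<close>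
      by (auto simp: relators_def act_diff act_add act_mult[of _ "gen _" "gen _"] act_gen act_one
          act_zero act_cylinder_relator[OF X] act_gen[of X "P _"])
  qed
qed

text \<open>The elements annihilating all functions supported in \<open>X\<close> form a two-sided
  ideal: a left factor acts on the zero function, a right factor preserves the support. This ideal
  contains the relators.\<close>

lemma act_relation_ideal:
  assumes X: "subshift X" and f: "f \<in> relation_ideal X"
    and \<phi>: "\<And>x. x \<notin> X \<Longrightarrow> \<phi> x = (0 :: 'r::comm_ring_1)"
  shows "act X f \<phi> = (\<lambda>x. 0)"
proof -
  let ?F = "free_algebra (generators X) :: ('a, 'r) free_alg ring"
  define K where "K = {f \<in> carrier ?F. \<forall>\<phi>. (\<forall>x. x \<notin> X \<longrightarrow> \<phi> x = 0) \<longrightarrow> act X f \<phi> = (\<lambda>x. 0)}"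
  interpret ring ?F by (rule ring_free_algebra)
  have ops: "f \<oplus>\<^bsub>?F\<^esub> g = f + g" "f \<otimes>\<^bsub>?F\<^esub> g = f * g" "\<zero>\<^bsub>?F\<^esub> = 0" for f g
    by (simp_all add: free_algebra_def)
  have act_0: "act X h (\<lambda>x. 0) = (\<lambda>x. 0)" for h :: "('a, 'r) free_alg"
    using act_mult[of X h 0] by (simp add: act_zero)
  have "ideal K ?F"
  proof (rule idealI[OF ring_free_algebra])
    show "subgroup K (add_monoid ?F)"
    proof (rule add.subgroupI)
      have "0 \<in> K" using zero_closed by (auto simp: K_def act_zero ops)
      then show "K \<noteq> {}" by blast
      show "\<ominus>\<^bsub>?F\<^esub> f \<in> K" if "f \<in> K" for f
      proof -
        have "f \<in> carrier ?F" using that by (simp add: K_def)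
        then have "f + \<ominus>\<^bsub>?F\<^esub> f = 0" "\<ominus>\<^bsub>?F\<^esub> f \<in> carrier ?F"
          using r_neg[of f] by (simp_all add: ops)
        moreover have "act X (\<ominus>\<^bsub>?F\<^esub> f) \<phi> x = act X (f + \<ominus>\<^bsub>?F\<^esub> f) \<phi> x - act X f \<phi> x" for \<phi> x
          by (simp add: act_add)
        ultimately show ?thesis using that by (auto simp: K_def act_zero)
      qed
      show "f \<oplus>\<^bsub>?F\<^esub> g \<in> K" if "f \<in> K" "g \<in> K" for f g
        using that a_closed[of f g] by (auto simp: K_def ops act_add)
    qed (auto simp: K_def)
    show "g \<otimes>\<^bsub>?F\<^esub> f \<in> K" if "f \<in> K" "g \<in> carrier ?F" for f g
      using that m_closed[of g f] by (auto simp: K_def ops act_mult act_0)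
    show "f \<otimes>\<^bsub>?F\<^esub> g \<in> K" if "f \<in> K" "g \<in> carrier ?F" for f g
      using that m_closed[of f g] act_outside[of g X] by (auto simp: K_def ops act_mult)
  qed
  moreover have "relators X \<subseteq> K"
    using relators_in_free_algebra act_relator[OF X] by (fastforce simp: K_def)
  ultimately have "relation_ideal X \<subseteq> K"
    unfolding relation_ideal_def by (rule genideal_minimal)
  then show ?thesis using f \<phi> by (auto simp: K_def)
qed

lemma cls_eq_zero_iff:
  assumes "f \<in> carrier (free_algebra (generators X))"
  shows "cls X f = \<zero>\<^bsub>subshift_algebra X\<^esub> \<longleftrightarrow> f \<in> relation_ideal X"
proof -
  interpret ideal "relation_ideal X" "free_algebra (generators X)"
    by (rule ideal_relation_ideal)
  show ?thesis
    using a_rcos_const a_rcos_self[OF assms]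
    by (auto simp: cls_def subshift_algebra_def FactRing_def)
qed

section \<open>The spectrum as a space of approximable configurations\<close>

abbreviation formal_value ::
  "(nat \<Rightarrow> 'a) set \<Rightarrow> ('r \<times> ('a list \<times> 'a list) list) list \<Rightarrow> ('a, 'r::comm_ring_1) free_alg" where
  "formal_value X t \<equiv> \<Sum>(r, bs) \<leftarrow> t. scalar r * (\<Prod>(\<beta>, \<gamma>) \<leftarrow> bs. gen (P (cyl X \<gamma> \<beta>)))"

abbreviation to_formal :: "('r \<times> ('a list \<times> 'a list) list) list \<Rightarrow> ('a, 'r) formal" where
  "to_formal t \<equiv> map (\<lambda>(r, bs). (r, map (\<lambda>(\<beta>, \<gamma>). word \<beta> - word \<gamma>) bs)) t"

definition lang_pairs :: "(nat \<Rightarrow> 'a) set \<Rightarrow> ('a list \<times> 'a list) set" where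
  "lang_pairs X = {(\<beta>, \<gamma>). \<beta> \<in> lang X \<and> \<gamma> \<in> lang X \<and> reduced_pair \<beta> \<gamma>}"

lemma gen_P_carrier: "A \<in> boolean_algebra_of X \<Longrightarrow> gen (P A) \<in> carrier (free_algebra (generators X))"
  by (intro gen_in_free_algebra) (simp add: generators_def)

lemma free_algebra_closed:
  assumes "f \<in> carrier (free_algebra G)" "g \<in> carrier (free_algebra G)"
  shows "f + g \<in> carrier (free_algebra G)" "f * g \<in> carrier (free_algebra G)"
    "f - g \<in> carrier (free_algebra G)"
proof -
  interpret ring "free_algebra G" by (rule ring_free_algebra)
  have add: "f + g \<in> carrier (free_algebra G)" if "g \<in> carrier (free_algebra G)" for g
    using a_closed[OF assms(1) that] by (simp add: free_algebra_def)
  show "f + g \<in> carrier (free_algebra G)" by (rule add[OF assms(2)])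
  show "f * g \<in> carrier (free_algebra G)"
    using m_closed[OF assms] by (simp add: free_algebra_def)
  have "- g \<in> carrier (free_algebra G)" using assms(2) by (simp add: free_algebra_def)
  from add[OF this] show "f - g \<in> carrier (free_algebra G)" by simp
qed

lemma scalar_carrier: "scalar r \<in> carrier (free_algebra G)"
  by (auto simp: free_algebra_def zero_free_monoid_def)

lemma relation_ideal_closed:
  assumes "f \<in> relation_ideal X"
  shows "g \<in> relation_ideal X \<Longrightarrow> f + g \<in> relation_ideal X"
    "g \<in> relation_ideal X \<Longrightarrow> f - g \<in> relation_ideal X"
    "h \<in> carrier (free_algebra (generators X)) \<Longrightarrow> f * h \<in> relation_ideal X"
proof -
  interpret ideal "relation_ideal X" "free_algebra (generators X)"
    by (rule ideal_relation_ideal)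
  have add: "f + g \<in> relation_ideal X" if "g \<in> relation_ideal X" for g
    using additive_subgroup.a_closed[OF is_additive_subgroup assms that] by (simp add: free_algebra_def)
  then show "g \<in> relation_ideal X \<Longrightarrow> f + g \<in> relation_ideal X" .
  show "f * h \<in> relation_ideal X" if "h \<in> carrier (free_algebra (generators X))"
    using I_r_closed[OF assms that] by (simp add: free_algebra_def)
  have "- g \<in> relation_ideal X" if "g \<in> relation_ideal X"
    using I_l_closed[OF that scalar_carrier[of "-1"]]
    by (simp add: free_algebra_def single_uminus)
  then show "g \<in> relation_ideal X \<Longrightarrow> f - g \<in> relation_ideal X" using add[of "- g"] by simp
qed

lemma relators_in_relation_ideal: "f \<in> relators X \<Longrightarrow> f \<in> relation_ideal X"
  unfolding relation_ideal_def
  using ring.genideal_self[OF ring_free_algebra relators_in_free_algebra] by blast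

lemma formal_value_carrier:
  assumes "\<And>r bs. (r, bs) \<in> set t \<Longrightarrow> set bs \<subseteq> lang_pairs X"
  shows "formal_value X t \<in> carrier (free_algebra (generators X))"
  using assms
proof (induction t)
  case Nil
  show ?case by (simp add: free_algebra_def)
next
  case (Cons p t)
  have "(\<Prod>(\<beta>, \<gamma>) \<leftarrow> bs. gen (P (cyl X \<gamma> \<beta>))) \<in> carrier (free_algebra (generators X))"
    if "set bs \<subseteq> lang_pairs X" for bs
    using that
    by (intro prod_list_in_free_algebra)
      (auto simp: lang_pairs_def intro!: gen_P_carrier boolean_algebra_of.cyl)
  then show ?case
    using Cons by (cases p) (auto intro!: free_algebra_closed scalar_carrier)
qed

text \<open>Products of \<open>P\<close> generators multiply by indicator functions of cylinders,
  and \<open>indicator X\<close> is 1 at \<open>x\<close>. By \<open>in_config_iff_cyl\<close> these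
  factors are the values of the formal symbols.\<close>

lemma act_formal_value:
  fixes t :: "('r::comm_ring_1 \<times> ('a list \<times> 'a list) list) list"
  assumes x: "x \<in> X" and t: "\<And>r bs. (r, bs) \<in> set t \<Longrightarrow> set bs \<subseteq> lang_pairs X"
  shows "act X (formal_value X t) (indicator X) x = eval_formal (to_formal t) (config X x)"
  using t
proof (induction t)
  case Nil
  show ?case by (simp add: act_zero eval_formal_def)
next
  case (Cons p t)
  obtain r bs where p: "p = (r, bs)" by fastforce
  have prod: "act X (\<Prod>(\<beta>, \<gamma>) \<leftarrow> bs. gen (P (cyl X \<gamma> \<beta>)) :: ('a, 'r) free_alg) (indicator X) x
      = (\<Prod>g \<leftarrow> map (\<lambda>(\<beta>, \<gamma>). word \<beta> - word \<gamma>) bs. if g \<in> config X x then 1 else 0)"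
    if "set bs \<subseteq> lang_pairs X" for bs
    using that
  proof (induction bs)
    case Nil
    show ?case using x by (simp add: act_one)
  next
    case (Cons b bs)
    then show ?case
      using in_config_iff_cyl[OF x]
      by (cases b) (auto simp: act_mult act_gen lang_pairs_def)
  qed
  have "act X (formal_value X t) (indicator X) x = eval_formal (to_formal t) (config X x)"
    using Cons.prems by (intro Cons.IH) auto
  then show ?case
    using prod[of bs] Cons.prems[of r bs] p
    by (simp add: act_add act_mult act_scalar eval_formal_def)
qed

text \<open>A relation of the first kind comes from an ideal element, which annihilates
  \<open>indicator X\<close>. For the second kind, \<open>g\<close> in the configuration would put
  \<open>s_word b * sstar_word c\<close> into the ideal, although it sends
  \<open>indicator X\<close> to a function with value 1 at \<open>x\<close>.\<close>

lemma eval_relation_config: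
  assumes X: "subshift X" and x: "x \<in> X" and f: "f \<in> (relations X :: ('a, 'r::comm_ring_1) formal set)"
  shows "eval_formal f (config X x) = 0"
proof -
  have "(\<exists>t. f = to_formal t \<and> (\<forall>(r, bs) \<in> set t. \<forall>(\<beta>, \<gamma>) \<in> set bs.
        \<beta> \<in> lang X \<and> \<gamma> \<in> lang X \<and> reduced_pair \<beta> \<gamma>) \<and>
        cls X (formal_value X t) = \<zero>\<^bsub>subshift_algebra X\<^esub>) \<or>
      (\<exists>g. f = [(1, [g])] \<and> (group_rep X g :: ('a, 'r) free_alg set) = \<zero>\<^bsub>subshift_algebra X\<^esub>)"
    using f unfolding relations_def by blast
  then consider t where "f = to_formal t" "\<And>r bs. (r, bs) \<in> set t \<Longrightarrow> set bs \<subseteq> lang_pairs X"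
      "cls X (formal_value X t) = \<zero>\<^bsub>subshift_algebra X\<^esub>"
    | g where "f = [(1, [g])]" "(group_rep X g :: ('a, 'r) free_alg set) = \<zero>\<^bsub>subshift_algebra X\<^esub>"
    by (force simp: lang_pairs_def)
  then show ?thesis
  proof cases
    case 1
    have "formal_value X t \<in> carrier (free_algebra (generators X))"
      by (rule formal_value_carrier) (use 1(2) in blast)
    then have "formal_value X t \<in> relation_ideal X"
      using 1(3) cls_eq_zero_iff by blast
    then have "act X (formal_value X t) (indicator X) = (\<lambda>x. 0)"
      by (rule act_relation_ideal[OF X]) simp
    then show ?thesis using act_formal_value[OF x, of t] 1(1,2) by simp
  next
    case 2
    have "g \<notin> config X x"
    proof
      assume "g \<in> config X x"
      then obtain b c where bc: "has_reduced_form g b c" "x \<in> cyl X c b"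
        using config_reduced_form[OF x] by blast
      then obtain z where z: "x = b \<frown> z" "c \<frown> z \<in> X" by (auto simp: cyl_def)
      have zX: "z \<in> X" using subshift_suffix[OF X z(2)] .
      have "cls X (s_word b * sstar_word c :: ('a, 'r) free_alg) = \<zero>\<^bsub>subshift_algebra X\<^esub>"
        unfolding 2(2)[symmetric]
        by (rule group_rep_eq[symmetric]) (use bc(1) z x in_lang in blast)+
      then have "(s_word b * sstar_word c :: ('a, 'r) free_alg) \<in> relation_ideal X"
        by (simp add: cls_eq_zero_iff free_algebra_closed word_in_free_algebra)
      then have "act X (s_word b * sstar_word c :: ('a, 'r) free_alg) (indicator X) x = 0"
        by (simp add: act_relation_ideal[OF X])
      moreover have "act X (s_word b * sstar_word c :: ('a, 'r) free_alg) (indicator X) x = 1"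
        using x z zX X by (simp add: act_mult act_s_word act_sstar_word)
      ultimately show False by simp
    qed
    then show ?thesis using 2 by (simp add: eval_formal_def)
  qed
qed

lemma eval_formal_cong:
  fixes f :: "('a, 'r::comm_ring_1) formal"
  assumes "\<And>r gs g. (r, gs) \<in> set f \<Longrightarrow> g \<in> set gs \<Longrightarrow> g \<in> \<xi> \<longleftrightarrow> g \<in> \<eta>"
  shows "eval_formal f \<xi> = eval_formal f \<eta>"
proof -
  have "(\<Prod>g \<leftarrow> gs. if g \<in> \<xi> then 1 else 0) = (\<Prod>g \<leftarrow> gs. if g \<in> \<eta> then 1 else (0 :: 'r))"
    if "(r, gs) \<in> set f" for r gs
    using assms[OF that] by (intro arg_cong[of _ _ prod_list] map_cong) auto
  then show ?thesis
    unfolding eval_formal_def by (intro arg_cong[of _ _ sum_list] map_cong) auto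
qed

lemma mem_translate: "g \<in> (+) (- h) ` \<xi> \<longleftrightarrow> h + g \<in> (\<xi> :: 'g::group_add set)"
  by (metis (no_types, lifting) add_minus_cancel image_iff minus_add_cancel)

text \<open>The partial product of the idempotents \<open>p\<close> and \<open>1 - p\<close> prescribed by \<open>cs\<close>, expanded into a
  formal expression.\<close>

lemma ex_formal_prescribed:
  assumes "snd ` set cs \<subseteq> lang_pairs X"
  shows "\<exists>t. (\<forall>(r, bs) \<in> set t. set bs \<subseteq> lang_pairs X) \<and>
    {x \<in> X. \<forall>(s, \<beta>, \<gamma>) \<in> set cs. (x \<in> cyl X \<gamma> \<beta>) = s} \<in> boolean_algebra_of X \<and>
    formal_value X t - gen (P {x \<in> X. \<forall>(s, \<beta>, \<gamma>) \<in> set cs. (x \<in> cyl X \<gamma> \<beta>) = s})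
      \<in> (relation_ideal X :: ('a, 'r::comm_ring_1) free_alg set) \<and>
    (\<forall>\<xi>. eval_formal (to_formal t) \<xi> =
      (if \<forall>(s, \<beta>, \<gamma>) \<in> set cs. (word \<beta> - word \<gamma> \<in> \<xi>) = s then 1 else 0))"
    (is "\<exists>t. ?T t \<and> ?A cs \<in> _ \<and> formal_value X t - gen (P (?A cs)) \<in> ?I \<and> ?E t cs")
  using assms
proof (induction cs)
  case Nil
  have "gen (P X) - 1 \<in> ?I" "0 \<in> ?I"
    using relators_in_relation_ideal[of "gen (P X) - 1" X] relation_ideal_closed(2)
    by (force simp: relators_def)+
  then have "1 - gen (P X) \<in> ?I" using relation_ideal_closed(2)[of 0 X "gen (P X) - 1"] by simp
  then show ?case
    by (intro exI[of _ "[(1, [])]"])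
      (simp add: space_in_boolean_algebra eval_formal_def)
next
  case (Cons c cs)
  obtain s \<beta> \<gamma> where c: "c = (s, \<beta>, \<gamma>)" by (cases c) auto
  have bc: "(\<beta>, \<gamma>) \<in> lang_pairs X" using Cons.prems c by simp
  then have C: "cyl X \<gamma> \<beta> \<in> boolean_algebra_of X"
    by (auto simp: lang_pairs_def intro: boolean_algebra_of.cyl)
  obtain t where t: "?T t" "?A cs \<in> boolean_algebra_of X"
    "formal_value X t - gen (P (?A cs)) \<in> ?I" "?E t cs"
    using Cons by auto
  let ?v = "formal_value X t :: ('a, 'r) free_alg" and ?B = "?A cs" and ?C = "cyl X \<gamma> \<beta>"
  let ?p = "\<lambda>A. gen (P A) :: ('a, 'r) free_alg"
  \<comment> \<open>Multiplication by the new factor, \<open>p\<close> for \<open>u\<close> and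
    \<open>1 - p\<close> for \<open>w\<close>, is carried out on the lists of terms.\<close>
  define u where "u = map (\<lambda>(r, bs). (r, bs @ [(\<beta>, \<gamma>)])) t"
  define w where "w = t @ map (\<lambda>(r, bs). (- r, bs @ [(\<beta>, \<gamma>)])) t"
  have val_u: "formal_value X u = ?v * ?p ?C"
    unfolding u_def by (induction t) (auto simp: distrib_right mult.assoc)
  have val_w: "formal_value X w = ?v - ?v * ?p ?C"
  proof -
    have "formal_value X (map (\<lambda>(r, bs). (- r, bs @ [(\<beta>, \<gamma>)])) t) = - (?v * ?p ?C)"
      by (induction t) (auto simp: distrib_right mult.assoc single_uminus)
    then show ?thesis by (simp add: w_def)
  qed
  have eval_u: "eval_formal (to_formal u) \<xi>
      = eval_formal (to_formal t) \<xi> * (if word \<beta> - word \<gamma> \<in> \<xi> then 1 else 0)" for \<xi>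
    unfolding u_def eval_formal_def by (induction t) (auto simp: distrib_right mult.assoc)
  have eval_w: "eval_formal (to_formal w) \<xi>
      = eval_formal (to_formal t) \<xi> * (if word \<beta> - word \<gamma> \<in> \<xi> then 0 else 1)" for \<xi>
  proof -
    have "eval_formal (to_formal (map (\<lambda>(r, bs). (- r, bs @ [(\<beta>, \<gamma>)])) t)) \<xi>
      = - (eval_formal (to_formal t) \<xi> * (if word \<beta> - word \<gamma> \<in> \<xi> then 1 else 0))"
      unfolding eval_formal_def by (induction t) (auto simp: distrib_right mult.assoc)
    then show ?thesis by (simp add: w_def eval_formal_def)
  qed
  have inter: "?p (?B \<inter> ?C) - ?p ?B * ?p ?C \<in> ?I"
    by (rule relators_in_relation_ideal) (use t(2) C in \<open>auto simp: relators_def\<close>)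
  have vC: "(?v - ?p ?B) * ?p ?C \<in> ?I"
    by (rule relation_ideal_closed(3)[OF t(3) gen_P_carrier[OF C]])
  show ?case
  proof (cases s)
    case True
    have A: "?A (c # cs) = ?B \<inter> ?C" using cyl_subset[of X] by (auto simp: c True)
    have "(?v - ?p ?B) * ?p ?C - (?p (?B \<inter> ?C) - ?p ?B * ?p ?C) \<in> ?I"
      by (rule relation_ideal_closed(2)[OF vC inter])
    then have "formal_value X u - ?p (?A (c # cs)) \<in> ?I"
      unfolding A val_u by (simp add: left_diff_distrib)
    moreover have "?T u" using t(1) bc by (fastforce simp: u_def)
    moreover have "?E u (c # cs)" using t(4) by (auto simp: c True eval_u)
    moreover have "?A (c # cs) \<in> boolean_algebra_of X"
      unfolding A using t(2) C by (rule boolean_algebra_of.inter)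
    ultimately show ?thesis by blast
  next
    case False
    have A: "?A (c # cs) = ?B \<inter> (X - ?C)" by (auto simp: c False)
    have D: "?B \<inter> (X - ?C) \<in> boolean_algebra_of X"
      using t(2) C by (intro boolean_algebra_of.inter boolean_algebra_of.compl)
    have E: "?B \<inter> ?C \<in> boolean_algebra_of X"
      using t(2) C by (rule boolean_algebra_of.inter)
    \<comment> \<open>This disjoint splitting of \<open>?B\<close> turns the relation for unions
      into additivity of \<open>?p\<close>, up to \<open>?p {}\<close>.\<close>
    have un: "?B \<inter> (X - ?C) \<union> ?B \<inter> ?C = ?B" and int: "?B \<inter> (X - ?C) \<inter> (?B \<inter> ?C) = {}"
      by blast+
    have "?p (?B \<inter> (X - ?C) \<union> ?B \<inter> ?C)
        - (?p (?B \<inter> (X - ?C)) + ?p (?B \<inter> ?C) - ?p (?B \<inter> (X - ?C) \<inter> (?B \<inter> ?C))) \<in> ?I"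
      by (rule relators_in_relation_ideal) (use D E in \<open>unfold relators_def, blast\<close>)
    then have un': "?p ?B - (?p (?B \<inter> (X - ?C)) + ?p (?B \<inter> ?C) - ?p {}) \<in> ?I"
      unfolding un int .
    have P0: "?p {} \<in> ?I"
      by (rule relators_in_relation_ideal) (simp add: relators_def)
    \<comment> \<open>A combination of ideal elements in which everything cancels except
      \<open>?v - ?v * ?p ?C\<close> and \<open>?p\<close> of the new set.\<close>
    have "(?v - ?p ?B) - (?v - ?p ?B) * ?p ?C
        + (?p ?B - (?p (?B \<inter> (X - ?C)) + ?p (?B \<inter> ?C) - ?p {}))
        + (?p (?B \<inter> ?C) - ?p ?B * ?p ?C) - ?p {} \<in> ?I"
      by (rule relation_ideal_closed(2)[OF relation_ideal_closed(1)[OF relation_ideal_closed(1)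
              [OF relation_ideal_closed(2)[OF t(3) vC] un'] inter] P0])
    then have "formal_value X w - ?p (?A (c # cs)) \<in> ?I"
      unfolding A val_w by (simp add: algebra_simps)
    moreover have "?T w" using t(1) bc by (fastforce simp: w_def)
    moreover have "?E w (c # cs)" using t(4) by (auto simp: c False eval_w)
    ultimately show ?thesis using D unfolding A by blast
  qed
qed

text \<open>The right-hand side describes the closure of the configurations in the pointwise
  topology; the study of orbits uses it instead of the relations.\<close>

theorem Omega_iff:
  assumes X: "subshift X"
  shows "\<xi> \<in> Omega TYPE('r::comm_ring_1) X \<longleftrightarrow>
    (\<forall>G. finite G \<longrightarrow> (\<exists>x\<in>X. \<forall>g\<in>G. g \<in> \<xi> \<longleftrightarrow> g \<in> config X x))"
proof
  assume \<xi>: "\<xi> \<in> Omega TYPE('r) X"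
  then have zero: "0 \<in> \<xi>" by (simp add: Omega_def)
  have rel: "eval_formal f \<xi> = 0" if "f \<in> relations X" for f :: "('a, 'r) formal"
  proof -
    have "eval_formal f \<in> Theta X" using that by (simp add: Theta_def)
    then have "eval_formal f ((+) (- 0) ` \<xi>) = 0" using \<xi> zero unfolding Omega_def by blast
    then show ?thesis by (simp add: image_def)
  qed
  \<comment> \<open>\<open>group_rep\<close> sends an element that is not \<open>valid\<close> to 0,
    which excludes it from \<open>\<xi>\<close>; by its form it is in no configuration
    either.\<close>
  define valid where "valid g \<longleftrightarrow> (\<exists>(\<beta>, \<gamma>)\<in>lang_pairs X. g = word \<beta> - word \<gamma>)" for g
  have invalid: "g \<notin> \<xi>" if "\<not> valid g" for g
  proof
    assume g: "g \<in> \<xi>"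
    have "group_rep X g = (\<zero>\<^bsub>subshift_algebra X\<^esub> :: ('a, 'r) free_alg set)"
      using that by (auto simp: group_rep_def valid_def lang_pairs_def has_reduced_form_def)
    then have "[(1, [g])] \<in> (relations X :: ('a, 'r) formal set)" by (simp add: relations_def)
    from rel[OF this] show False using g by (simp add: eval_formal_def)
  qed
  have invalid_config: "g \<notin> config X x" if inv: "\<not> valid g" and x: "x \<in> X" for g x
  proof
    assume "g \<in> config X x"
    then obtain b c where bc: "has_reduced_form g b c" "x \<in> cyl X c b"
      using config_reduced_form x by blast
    then have "b \<in> lang X" "c \<in> lang X" using cyl_empty_if_not_lang by blast+
    then show False using inv bc by (auto simp: valid_def lang_pairs_def has_reduced_form_def)
  qed
  show "\<forall>G. finite G \<longrightarrow> (\<exists>x\<in>X. \<forall>g\<in>G. g \<in> \<xi> \<longleftrightarrow> g \<in> config X x)"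
  proof (intro allI impI)
    fix G :: "'a free_group set" assume "finite G"
    then obtain gs where gs: "set gs = {g \<in> G. valid g}" using finite_list[of "{g \<in> G. valid g}"] by auto
    define p where "p g = (SOME p. p \<in> lang_pairs X \<and> g = word (fst p) - word (snd p))" for g
    have p: "p g \<in> lang_pairs X \<and> g = word (fst (p g)) - word (snd (p g))" if "valid g" for g
      unfolding p_def by (rule someI_ex) (use that in \<open>force simp: valid_def\<close>)
    \<comment> \<open>Each pair carries the truth value that \<open>\<xi>\<close> gives to its group
      element, so the prescribed product has the value 1 at \<open>\<xi>\<close>.\<close>
    define cs where "cs = map (\<lambda>g. (g \<in> \<xi>, p g)) gs"
    have "snd ` set cs \<subseteq> lang_pairs X" using p gs by (auto simp: cs_def)
    from ex_formal_prescribed[OF this, where 'r = 'r] obtain t :: "('r \<times> ('a list \<times> 'a list) list) list" where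
      t: "\<And>r bs. (r, bs) \<in> set t \<Longrightarrow> set bs \<subseteq> lang_pairs X" and
      val: "formal_value X t - gen (P {x \<in> X. \<forall>(s, \<beta>, \<gamma>) \<in> set cs. (x \<in> cyl X \<gamma> \<beta>) = s}) \<in> relation_ideal X" and
      ev: "eval_formal (to_formal t) \<xi> =
        (if \<forall>(s, \<beta>, \<gamma>) \<in> set cs. (word \<beta> - word \<gamma> \<in> \<xi>) = s then 1 else 0)"
      by fast
    have "word (fst (p g)) - word (snd (p g)) = g" if "g \<in> set gs" for g
      using p gs that by auto
    then have "eval_formal (to_formal t) \<xi> = 1"
      unfolding ev by (auto simp: cs_def case_prod_beta)
    \<comment> \<open>A relation would have the value 0 at \<open>\<xi>\<close>. So the product is
      nonzero in the algebra, and the set representing it is not empty.\<close>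
    then have "to_formal t \<notin> relations X" using rel[of "to_formal t"] by auto
    moreover have "to_formal t \<in> relations X"
      if "cls X (formal_value X t) = \<zero>\<^bsub>subshift_algebra X\<^esub>"
      unfolding relations_def
      by (intro UnI1 CollectI exI[of _ t] conjI that refl) (use t in \<open>fastforce simp: lang_pairs_def\<close>)
    moreover have "formal_value X t \<in> carrier (free_algebra (generators X))"
      by (rule formal_value_carrier) (use t in blast)
    ultimately have nin: "formal_value X t \<notin> relation_ideal X"
      using cls_eq_zero_iff by blast
    have P0: "gen (P {}) \<in> (relation_ideal X :: ('a, 'r) free_alg set)"
      by (rule relators_in_relation_ideal) (simp add: relators_def)
    have "{x \<in> X. \<forall>(s, \<beta>, \<gamma>) \<in> set cs. (x \<in> cyl X \<gamma> \<beta>) = s} \<noteq> {}" (is "?A \<noteq> {}")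
    proof
      assume e: "?A = {}"
      show False using relation_ideal_closed(1)[OF val[unfolded e] P0] nin by simp
    qed
    then obtain x where x: "x \<in> X" "\<And>s \<beta> \<gamma>. (s, \<beta>, \<gamma>) \<in> set cs \<Longrightarrow> (x \<in> cyl X \<gamma> \<beta>) = s"
      by blast
    have "g \<in> \<xi> \<longleftrightarrow> g \<in> config X x" if g: "g \<in> G" for g
    proof (cases "valid g")
      case True
      obtain \<beta> \<gamma> where bc: "p g = (\<beta>, \<gamma>)" by fastforce
      have "(g \<in> \<xi>, \<beta>, \<gamma>) \<in> set cs" using True g gs bc by (force simp: cs_def)
      from x(2)[OF this] have "g \<in> \<xi> \<longleftrightarrow> x \<in> cyl X \<gamma> \<beta>" by simp
      moreover have "g = word \<beta> - word \<gamma>" "reduced_pair \<beta> \<gamma>"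
        using p[OF True] bc by (auto simp: lang_pairs_def)
      ultimately show ?thesis using in_config_iff_cyl[OF x(1)] by simp
    qed (use invalid invalid_config x in blast)
    then show "\<exists>x\<in>X. \<forall>g\<in>G. g \<in> \<xi> \<longleftrightarrow> g \<in> config X x" using x(1) by blast
  qed
next
  assume *: "\<forall>G. finite G \<longrightarrow> (\<exists>x\<in>X. \<forall>g\<in>G. g \<in> \<xi> \<longleftrightarrow> g \<in> config X x)"
  from *[rule_format, of "{0}"] have "0 \<in> \<xi>" using zero_in_config by auto
  moreover have "eval_formal f ((+) (- h) ` \<xi>) = 0" if f: "f \<in> relations X" and h: "h \<in> \<xi>"
    for f :: "('a, 'r) formal" and h
  proof -
    \<comment> \<open>\<open>H\<close> collects the group elements occurring in \<open>f\<close>.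
      Approximating \<open>\<xi>\<close> at \<open>h\<close> and on the translate of
      \<open>H\<close> by \<open>h\<close> leads to the configuration of
      \<open>c \<frown> z\<close>, where the relations hold.\<close>
    define H where "H = (\<Union>(r, gs)\<in>set f. set gs)"
    have "finite (insert h ((+) h ` H))" by (auto simp: H_def)
    from *[rule_format, OF this]
    obtain x where x: "x \<in> X" "\<forall>g\<in>insert h ((+) h ` H). g \<in> \<xi> \<longleftrightarrow> g \<in> config X x"
      by blast
    then have "h \<in> config X x" using h by simp
    then obtain b c z where z: "h = word b - word c" "x = b \<frown> z" "c \<frown> z \<in> X"
      by (auto simp: config_def)
    have "eval_formal f ((+) (- h) ` \<xi>) = eval_formal f (config X (c \<frown> z))"
    proof (rule eval_formal_cong)
      fix r gs g assume "(r, gs) \<in> set f" "g \<in> set gs"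
      then have "g \<in> H" by (auto simp: H_def)
      then show "g \<in> (+) (- h) ` \<xi> \<longleftrightarrow> g \<in> config X (c \<frown> z)"
        using x(2) config_shift[of b z X c g] x(1) z(3)
        unfolding mem_translate z(1,2) by blast
    qed
    also have "\<dots> = 0" by (rule eval_relation_config[OF X z(3) f])
    finally show ?thesis .
  qed
  ultimately show "\<xi> \<in> Omega TYPE('r) X" by (auto simp: Omega_def Theta_def)
qed

section \<open>Density and compactness\<close>

lemma openin_product_discrete:
  assumes "finite G" and "\<And>\<chi> \<chi>'. \<chi> \<in> U \<Longrightarrow> (\<And>g. g \<in> G \<Longrightarrow> \<chi>' g = \<chi> g) \<Longrightarrow> \<chi>' \<in> U"
  shows "openin (product_topology (\<lambda>_. discrete_topology UNIV) UNIV) U"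
  unfolding openin_product_topology_alt
proof
  fix \<chi> assume \<chi>: "\<chi> \<in> U"
  let ?V = "\<lambda>g. if g \<in> G then {\<chi> g} else UNIV"
  have "finite {g \<in> UNIV. ?V g \<noteq> topspace (discrete_topology UNIV)}"
    by (rule finite_subset[OF _ assms(1)]) auto
  moreover have "\<chi> \<in> Pi\<^sub>E UNIV ?V" by auto
  moreover have "\<chi>' \<in> U" if *: "\<chi>' \<in> Pi\<^sub>E UNIV ?V" for \<chi>'
  proof -
    have "\<chi>' g = \<chi> g" if "g \<in> G" for g using PiE_mem[OF *, of g] that by simp
    then show ?thesis by (rule assms(2)[OF \<chi>])
  qed
  ultimately show "\<exists>V. finite {g \<in> UNIV. V g \<noteq> topspace (discrete_topology UNIV)} \<and>
      (\<forall>g\<in>UNIV. openin (discrete_topology UNIV) (V g)) \<and> \<chi> \<in> Pi\<^sub>E UNIV V \<and> Pi\<^sub>E UNIV V \<subseteq> U"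
    by (intro exI[of _ ?V] conjI subsetI) simp_all
qed

text \<open>Boxes restricting finitely many coordinates form a base of the product topology.\<close>

lemma in_closure_of_Omega_space:
  fixes R :: "'r::comm_ring_1 itself"
  assumes "\<S> \<subseteq> Omega R X"
  shows "\<eta> \<in> Omega_space R X closure_of \<S> \<longleftrightarrow>
    \<eta> \<in> Omega R X \<and> (\<forall>G. finite G \<longrightarrow> (\<exists>\<xi>\<in>\<S>. \<forall>g\<in>G. g \<in> \<xi> \<longleftrightarrow> g \<in> \<eta>))"
    (is "?L \<longleftrightarrow> ?R")
proof
  assume L: ?L
  then have \<eta>: "\<eta> \<in> Omega R X" by (simp add: in_closure_of topspace_Omega_space)
  moreover have "\<exists>\<xi>\<in>\<S>. \<forall>g\<in>G. g \<in> \<xi> \<longleftrightarrow> g \<in> \<eta>" if G: "finite G" for G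
  proof -
    let ?U = "{\<chi>. \<forall>g\<in>G. \<chi> g = (g \<in> \<eta>)}"
    define T where "T = (\<lambda>\<xi> g. g \<in> \<xi>) -` ?U \<inter> {\<xi>. 0 \<in> \<xi>} \<inter> Omega R X"
    have "openin (product_topology (\<lambda>_. discrete_topology UNIV) UNIV) ?U"
      by (rule openin_product_discrete[OF G]) auto
    then have "openin power_space ((\<lambda>\<xi> g. g \<in> \<xi>) -` ?U \<inter> {\<xi>. 0 \<in> \<xi>})"
      unfolding power_space_def openin_pullback_topology by (intro exI[of _ ?U] conjI refl)
    then have "openin (Omega_space R X) T"
      unfolding Omega_space_def openin_subtopology T_def
      by (intro exI conjI) (assumption, rule refl)
    moreover have "\<eta> \<in> T" using \<eta> by (auto simp: T_def Omega_def)
    ultimately obtain \<xi> where "\<xi> \<in> \<S>" "\<xi> \<in> T"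
      using L[unfolded in_closure_of] by blast
    then have "\<forall>g\<in>G. g \<in> \<xi> \<longleftrightarrow> g \<in> \<eta>" by (simp add: T_def)
    with \<open>\<xi> \<in> \<S>\<close> show ?thesis by blast
  qed
  ultimately show ?R by blast
next
  assume R: ?R
  have "\<exists>\<xi>. \<xi> \<in> \<S> \<and> \<xi> \<in> T" if T: "\<eta> \<in> T" "openin (Omega_space R X) T" for T
  proof -
    obtain U where U: "openin (product_topology (\<lambda>_. discrete_topology UNIV) UNIV) U"
      and TU: "T = (\<lambda>\<xi> g. g \<in> \<xi>) -` U \<inter> {\<xi>. 0 \<in> \<xi>} \<inter> Omega R X"
      using T(2) unfolding Omega_space_def power_space_def openin_subtopology openin_pullback_topology
      by auto
    have "(\<lambda>g. g \<in> \<eta>) \<in> U" using T(1) TU by blast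
    then obtain V where V: "finite {g. V g \<noteq> UNIV}" "(\<lambda>g. g \<in> \<eta>) \<in> Pi\<^sub>E UNIV V" "Pi\<^sub>E UNIV V \<subseteq> U"
      using U unfolding openin_product_topology_alt by auto
    obtain \<xi> where \<xi>: "\<xi> \<in> \<S>" "\<forall>g\<in>{g. V g \<noteq> UNIV}. g \<in> \<xi> \<longleftrightarrow> g \<in> \<eta>"
      using R V(1) by blast
    have "(g \<in> \<xi>) \<in> V g" for g
      using \<xi>(2) V(2) PiE_mem[OF V(2), of g] by (cases "V g = UNIV") auto
    then have "(\<lambda>g. g \<in> \<xi>) \<in> U" by (intro subsetD[OF V(3)] PiE_I) auto
    moreover have "\<xi> \<in> Omega R X" "0 \<in> \<xi>" using \<xi>(1) assms by (auto simp: Omega_def)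
    ultimately show ?thesis using \<xi>(1) TU by blast
  qed
  then show ?L using R by (simp add: in_closure_of topspace_Omega_space)
qed

text \<open>By compactness of the product of two-point spaces: each \<open>C G\<close> is closed
  because it only looks at coordinates in \<open>G\<close>, and a member of \<open>\<S>\<close> at
  the union of finitely many \<open>G\<close> lies in all their \<open>C G\<close>.\<close>

lemma finite_approximation_limit:
  fixes \<S> :: "'g set \<Rightarrow> 'g set set"
  assumes ne: "\<And>G. finite G \<Longrightarrow> \<S> G \<noteq> {}" and anti: "\<And>G H. finite H \<Longrightarrow> G \<subseteq> H \<Longrightarrow> \<S> H \<subseteq> \<S> G"
  obtains \<xi> where "\<And>G. finite G \<Longrightarrow> \<exists>\<eta>\<in>\<S> G. \<forall>g\<in>G. g \<in> \<eta> \<longleftrightarrow> g \<in> \<xi>"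
proof -
  let ?T = "product_topology (\<lambda>_ :: 'g. discrete_topology (UNIV :: bool set)) UNIV"
  define C where "C G = {\<chi> :: 'g \<Rightarrow> bool. \<exists>\<eta>\<in>\<S> G. \<forall>g\<in>G. \<chi> g = (g \<in> \<eta>)}" for G
  have "compact_space ?T"
    by (simp add: compact_space_product_topology compact_space_discrete_topology)
  moreover have "closedin ?T A" if A: "A \<in> C ` {G. finite G}" for A
  proof -
    obtain G where G: "finite G" "A = C G" using A by blast
    have "openin ?T (UNIV - A)"
      unfolding G(2) by (rule openin_product_discrete[OF G(1)]) (auto simp: C_def)
    then show ?thesis by (simp add: closedin_def)
  qed
  moreover have "\<Inter>\<F> \<noteq> {}" if F: "finite \<F>" "\<F> \<subseteq> C ` {G. finite G}" for \<F>
  proof -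
    obtain \<G> where \<G>: "\<G> \<subseteq> {G. finite G}" "finite \<G>" "\<F> = C ` \<G>"
      using finite_subset_image[OF F] by blast
    then have fin: "finite (\<Union>\<G>)" by blast
    then obtain \<eta> where \<eta>: "\<eta> \<in> \<S> (\<Union>\<G>)" using ne by blast
    have "(\<lambda>g. g \<in> \<eta>) \<in> C G" if "G \<in> \<G>" for G
      using anti[OF fin, of G] that \<eta> by (auto simp: C_def)
    then show ?thesis unfolding \<G>(3) by blast
  qed
  ultimately have "\<Inter>(C ` {G. finite G}) \<noteq> {}"
    unfolding compact_space_fip by (elim allE[of _ "C ` {G. finite G}"]) blast
  then obtain \<chi> where \<chi>: "\<And>G. finite G \<Longrightarrow> \<chi> \<in> C G" by blast
  show thesis
  proof (rule that[of "Collect \<chi>"])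
    show "\<exists>\<eta>\<in>\<S> G. \<forall>g\<in>G. g \<in> \<eta> \<longleftrightarrow> g \<in> Collect \<chi>" if "finite G" for G
      using \<chi>[OF that] by (auto simp: C_def)
  qed
qed

lemma config_in_Omega:
  assumes "subshift X" "x \<in> X"
  shows "config X x \<in> Omega TYPE('r::comm_ring_1) X"
  using assms by (auto simp: Omega_iff)

lemma orbit_subset_Omega: "orbit R X \<xi> \<subseteq> Omega R X"
  using theta_maps[of _ R X] by (fastforce simp: orbit_def Omega_at_def)

text \<open>Since the configurations are dense, it is enough to approach them. The element
  \<open>h\<close> is the inverse of the translating one, and \<open>h \<in> \<xi>\<close> says that
  the translation is defined at \<open>\<xi>\<close>.\<close>

lemma minimal_theta_iff:
  assumes X: "subshift X"
  shows "minimal_theta TYPE('r::comm_ring_1) X \<longleftrightarrow>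
    (\<forall>\<xi>\<in>Omega TYPE('r) X. \<forall>x\<in>X. \<forall>G. finite G \<longrightarrow>
      (\<exists>h\<in>\<xi>. \<forall>g\<in>G. h + g \<in> \<xi> \<longleftrightarrow> g \<in> config X x))"
proof
  assume min: "minimal_theta TYPE('r) X"
  show "\<forall>\<xi>\<in>Omega TYPE('r) X. \<forall>x\<in>X. \<forall>G. finite G \<longrightarrow>
      (\<exists>h\<in>\<xi>. \<forall>g\<in>G. h + g \<in> \<xi> \<longleftrightarrow> g \<in> config X x)"
  proof (intro ballI allI impI)
    fix \<xi> x and G :: "'a free_group set"
    assume \<xi>: "\<xi> \<in> Omega TYPE('r) X" and x: "x \<in> X" and G: "finite G"
    have "config X x \<in> Omega_space TYPE('r) X closure_of orbit TYPE('r) X \<xi>"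
      using min \<xi> config_in_Omega[OF X x] unfolding minimal_theta_def by blast
    then obtain \<zeta> where \<zeta>: "\<zeta> \<in> orbit TYPE('r) X \<xi>" "\<forall>g\<in>G. g \<in> \<zeta> \<longleftrightarrow> g \<in> config X x"
      using G in_closure_of_Omega_space[OF orbit_subset_Omega] by blast
    obtain k where k: "\<zeta> = theta k \<xi>" "- k \<in> \<xi>"
      using \<zeta>(1) by (auto simp: orbit_def Omega_at_def)
    have "g \<in> \<zeta> \<longleftrightarrow> - k + g \<in> \<xi>" for g
      using mem_translate[of g "- k" \<xi>] by (simp add: k(1) theta_def)
    then show "\<exists>h\<in>\<xi>. \<forall>g\<in>G. h + g \<in> \<xi> \<longleftrightarrow> g \<in> config X x" using \<zeta>(2) k(2) by blast
  qed
next
  assume *: "\<forall>\<xi>\<in>Omega TYPE('r) X. \<forall>x\<in>X. \<forall>G. finite G \<longrightarrow>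
      (\<exists>h\<in>\<xi>. \<forall>g\<in>G. h + g \<in> \<xi> \<longleftrightarrow> g \<in> config X x)"
  show "minimal_theta TYPE('r) X"
    unfolding minimal_theta_def
  proof (intro ballI equalityI subsetI)
    fix \<xi> \<eta> assume \<xi>: "\<xi> \<in> Omega TYPE('r) X" and \<eta>: "\<eta> \<in> Omega TYPE('r) X"
    have "\<exists>\<zeta>\<in>orbit TYPE('r) X \<xi>. \<forall>g\<in>G. g \<in> \<zeta> \<longleftrightarrow> g \<in> \<eta>" if G: "finite G" for G
    proof -
      obtain x where x: "x \<in> X" "\<forall>g\<in>G. g \<in> \<eta> \<longleftrightarrow> g \<in> config X x"
        using \<eta> G unfolding Omega_iff[OF X] by blast
      obtain h where h: "h \<in> \<xi>" "\<forall>g\<in>G. h + g \<in> \<xi> \<longleftrightarrow> g \<in> config X x"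
        using * \<xi> x(1) G by blast
      have "theta (- h) \<xi> \<in> orbit TYPE('r) X \<xi>"
        using \<xi> h(1) unfolding orbit_def Omega_at_def by auto
      moreover have "g \<in> theta (- h) \<xi> \<longleftrightarrow> h + g \<in> \<xi>" for g
        unfolding theta_def by (rule mem_translate)
      ultimately show ?thesis using h(2) x(2) by blast
    qed
    then show "\<eta> \<in> Omega_space TYPE('r) X closure_of orbit TYPE('r) X \<xi>"
      using \<eta> in_closure_of_Omega_space[OF orbit_subset_Omega] by blast
  qed (simp add: in_closure_of topspace_Omega_space)
qed

section \<open>Uniformly finite cofinality\<close>

definition finitely_cofinal :: "(nat \<Rightarrow> 'a) set \<Rightarrow> bool" where
  "finitely_cofinal X \<longleftrightarrow>
     (\<forall>B. finite B \<and> B \<subseteq> lang X \<and> followers X B \<noteq> {} \<longrightarrow>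
       (\<exists>P. finite P \<and> P \<subseteq> lang X \<times> lang X \<and>
          (\<forall>x\<in>X. \<exists>(\<alpha>, \<gamma>)\<in>P. \<forall>\<beta>\<in>B. x \<in> cyl X (\<beta> @ \<gamma>) \<alpha>)))"

lemma minimal_theta_imp_finitely_cofinal:
  assumes X: "subshift X" and min: "minimal_theta TYPE('r::comm_ring_1) X"
  shows "finitely_cofinal X"
  unfolding finitely_cofinal_def
proof (intro allI impI)
  fix B assume "finite B \<and> B \<subseteq> lang X \<and> followers X B \<noteq> {}"
  then obtain x where B: "finite B" and "x \<in> followers X B" by blast
  then have x: "x \<in> X" "\<beta> \<in> B \<Longrightarrow> \<beta> \<frown> x \<in> X" for \<beta>
    by (auto simp: followers_iff)
  \<comment> \<open>Translating by the inverse of a \<open>good\<close> element gives a set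
    containing the inverses of all words in \<open>B\<close>. Only finitely many memberships are
    involved, so goodness survives approximation.\<close>
  define good where "good k \<xi> \<longleftrightarrow> k \<in> \<xi> \<and> (\<forall>\<beta>\<in>B. k - word \<beta> \<in> \<xi>)" for k \<xi>
  have ex_good: "\<exists>k. good k \<xi>" if \<xi>: "\<xi> \<in> Omega TYPE('r) X" for \<xi>
  proof -
    have "- word \<beta> \<in> config X x" if "\<beta> \<in> B" for \<beta>
      using in_configI[of x "[]" x \<beta> X] x(2)[OF that] by (simp add: word_Nil)
    moreover obtain h where "h \<in> \<xi>" "\<forall>g\<in>(\<lambda>\<beta>. - word \<beta>) ` B. h + g \<in> \<xi> \<longleftrightarrow> g \<in> config X x"
      using min[unfolded minimal_theta_iff[OF X], rule_format, OF \<xi> x(1), of "(\<lambda>\<beta>. - word \<beta>) ` B"] B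
      by blast
    ultimately show ?thesis by (auto simp: good_def)
  qed
  have "\<exists>K. finite K \<and> (\<forall>y\<in>X. \<exists>k\<in>K. good k (config X y))"
  proof (rule ccontr)
    assume no: "\<not> ?thesis"
    \<comment> \<open>If every finite \<open>K\<close> missed a point, a limit of the missed
      configurations would lie in the spectrum and have no good element.\<close>
    define \<S> where "\<S> K = config X ` {y \<in> X. \<forall>k\<in>K. \<not> good k (config X y)}" for K
    have "\<S> K \<noteq> {}" if "finite K" for K using no that by (auto simp: \<S>_def)
    moreover have "\<S> H \<subseteq> \<S> G" if "G \<subseteq> H" for G H using that by (auto simp: \<S>_def)
    ultimately obtain \<xi> where \<xi>: "\<And>G. finite G \<Longrightarrow> \<exists>\<eta>\<in>\<S> G. \<forall>g\<in>G. g \<in> \<eta> \<longleftrightarrow> g \<in> \<xi>"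
      using finite_approximation_limit[of \<S>] by metis
    have "\<xi> \<in> Omega TYPE('r) X"
      unfolding Omega_iff[OF X]
    proof (intro allI impI)
      fix G :: "'a free_group set" assume "finite G"
      then show "\<exists>x\<in>X. \<forall>g\<in>G. (g \<in> \<xi>) = (g \<in> config X x)" using \<xi>[of G] by (auto simp: \<S>_def)
    qed
    then obtain k where k: "good k \<xi>" using ex_good by blast
    obtain \<eta> where "\<eta> \<in> \<S> (insert k ((\<lambda>\<beta>. k - word \<beta>) ` B))"
      "\<forall>g\<in>insert k ((\<lambda>\<beta>. k - word \<beta>) ` B). g \<in> \<eta> \<longleftrightarrow> g \<in> \<xi>"
      using \<xi>[of "insert k ((\<lambda>\<beta>. k - word \<beta>) ` B)"] B by blast
    then show False using k by (auto simp: \<S>_def good_def)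
  qed
  then obtain K where K: "finite K" "\<And>y. y \<in> X \<Longrightarrow> \<exists>k\<in>K. good k (config X y)" by blast
  \<comment> \<open>\<open>form k\<close> is arbitrary when \<open>k\<close> has no reduced form;
    \<open>P\<close> keeps only pairs of words of the language.\<close>
  define form where "form k = (SOME p. has_reduced_form k (fst p) (snd p))" for k :: "'a free_group"
  define P where "P = form ` K \<inter> lang X \<times> lang X"
  have "\<exists>(\<alpha>, \<gamma>)\<in>P. \<forall>\<beta>\<in>B. y \<in> cyl X (\<beta> @ \<gamma>) \<alpha>" if y: "y \<in> X" for y
  proof -
    obtain k where k: "k \<in> K" "k \<in> config X y" "\<And>\<beta>. \<beta> \<in> B \<Longrightarrow> k - word \<beta> \<in> config X y"
      using K(2)[OF y] by (auto simp: good_def)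
    obtain \<alpha> \<gamma> where red: "has_reduced_form k \<alpha> \<gamma>" and cyl: "y \<in> cyl X \<gamma> \<alpha>"
      using config_reduced_form[OF y k(2)] by blast
    obtain v where v: "y = \<alpha> \<frown> v" "\<gamma> \<frown> v \<in> X" using cyl by (auto simp: cyl_def)
    have "has_reduced_form k (fst (form k)) (snd (form k))"
      unfolding form_def by (rule someI[of _ "(\<alpha>, \<gamma>)"]) (simp add: red)
    then have "form k = (\<alpha>, \<gamma>)" using has_reduced_form_unique[OF red] by (simp add: prod_eq_iff)
    moreover have "\<alpha> \<in> lang X" "\<gamma> \<in> lang X" using y v in_lang by blast+
    ultimately have "(\<alpha>, \<gamma>) \<in> P" using k(1) by (force simp: P_def)
    moreover have "y \<in> cyl X (\<beta> @ \<gamma>) \<alpha>" if \<beta>: "\<beta> \<in> B" for \<beta>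
    proof -
      \<comment> \<open>Passing from \<open>y\<close> to \<open>\<gamma> \<frown> v\<close> cancels
        \<open>k\<close> and leaves the inverse of \<open>\<beta>\<close>, whose membership means
        \<open>\<beta> \<frown> (\<gamma> \<frown> v) \<in> X\<close>.\<close>
      have "word \<alpha> - word \<gamma> + (word [] - word \<beta>) \<in> config X (\<alpha> \<frown> v)"
        using k(3)[OF \<beta>] red v(1) by (simp add: has_reduced_form_def word_Nil)
      then have "word [] - word \<beta> \<in> config X (\<gamma> \<frown> v)"
        using config_shift[of \<alpha> v X \<gamma>] y v by blast
      then have "\<gamma> \<frown> v \<in> cyl X \<beta> []"
        using in_config_iff_cyl[OF v(2), of "[]" \<beta>] by (simp add: reduced_pair_def)
      then show ?thesis using y v by (auto simp: cyl_def)
    qed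
    ultimately show ?thesis by blast
  qed
  moreover have "finite P" "P \<subseteq> lang X \<times> lang X" using K(1) by (auto simp: P_def)
  ultimately show "\<exists>P. finite P \<and> P \<subseteq> lang X \<times> lang X \<and>
      (\<forall>x\<in>X. \<exists>(\<alpha>, \<gamma>)\<in>P. \<forall>\<beta>\<in>B. x \<in> cyl X (\<beta> @ \<gamma>) \<alpha>)" by blast
qed

lemma finitely_cofinal_imp_minimal_theta:
  assumes X: "subshift X" and fc: "finitely_cofinal X"
  shows "minimal_theta TYPE('r::comm_ring_1) X"
  unfolding minimal_theta_iff[OF X]
proof (intro ballI allI impI)
  fix \<xi> x and G :: "'a free_group set"
  assume \<xi>: "\<xi> \<in> Omega TYPE('r) X" and x: "x \<in> X" and G: "finite G"
  have "\<forall>\<^sub>F m in sequentially. \<forall>g\<in>G.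
    (g \<in> config X x \<longrightarrow> (\<exists>c. g = word (prefix m x) - word c \<and> c \<frown> suffix m x \<in> X)) \<and>
    (g \<notin> config X x \<longrightarrow> (\<forall>y\<in>X. prefix m y = prefix m x \<longrightarrow> g \<notin> config X y))"
    using G eventually_config_eq[OF X x] by (simp add: eventually_ball_finite_distrib)
  then obtain m where
    pos: "\<And>g. g \<in> G \<Longrightarrow> g \<in> config X x \<Longrightarrow> \<exists>c. g = word (prefix m x) - word c \<and> c \<frown> suffix m x \<in> X" and
    neg: "\<And>g y. g \<in> G \<Longrightarrow> g \<notin> config X x \<Longrightarrow> y \<in> X \<Longrightarrow> prefix m y = prefix m x \<Longrightarrow> g \<notin> config X y"
    using eventually_happens'[OF sequentially_bot] by blast
  define b where "b = prefix m x"
  have "\<forall>g\<in>G \<inter> config X x. \<exists>c. g = word b - word c \<and> c \<frown> suffix m x \<in> X"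
    using pos unfolding b_def by blast
  from bchoice[OF this] obtain c where
    c: "\<And>g. g \<in> G \<Longrightarrow> g \<in> config X x \<Longrightarrow> g = word b - word (c g) \<and> c g \<frown> suffix m x \<in> X"
    by blast
  \<comment> \<open>Besides \<open>b\<close>, \<open>B\<close> holds a denominator
    \<open>c g\<close> for each \<open>g\<close> in \<open>G\<close> belonging to the configuration
    of \<open>x\<close>; all these words may precede \<open>suffix m x\<close>.\<close>
  define B where "B = insert b (c ` (G \<inter> config X x))"
  have "b \<frown> suffix m x \<in> X" using x prefix_suffix[of x m] by (simp add: b_def)
  then have Bx: "\<beta> \<frown> suffix m x \<in> X" if "\<beta> \<in> B" for \<beta> using that c by (auto simp: B_def)
  then have "suffix m x \<in> followers X B"
    using subshift_suffix[OF X] by (auto simp: followers_iff B_def)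
  moreover have "finite B" "B \<subseteq> lang X" using G Bx in_lang by (auto simp: B_def)
  ultimately obtain P where P: "finite P" "P \<subseteq> lang X \<times> lang X"
    "\<And>y. y \<in> X \<Longrightarrow> \<exists>(\<alpha>, \<gamma>)\<in>P. \<forall>\<beta>\<in>B. y \<in> cyl X (\<beta> @ \<gamma>) \<alpha>"
    using fc[unfolded finitely_cofinal_def, rule_format, of B] by blast
  \<comment> \<open>As \<open>P\<close> is finite and independent of the point, the candidates for
    \<open>h\<close> are known in advance. So one \<open>config X y\<close> approximates
    \<open>\<xi>\<close> at all of them and at their products with \<open>G\<close>.\<close>
  define k where "k = (\<lambda>(\<alpha>, \<gamma>). word \<alpha> - word (b @ \<gamma>))"
  define H where "H = k ` P \<union> (\<Union>p\<in>P. (+) (k p) ` G)"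
  have "finite H" using P(1) G by (simp add: H_def)
  then obtain y where y: "y \<in> X" "\<And>h. h \<in> H \<Longrightarrow> h \<in> \<xi> \<longleftrightarrow> h \<in> config X y"
    using \<xi> unfolding Omega_iff[OF X] by blast
  obtain \<alpha> \<gamma> where p: "(\<alpha>, \<gamma>) \<in> P" and D: "\<And>\<beta>. \<beta> \<in> B \<Longrightarrow> y \<in> cyl X (\<beta> @ \<gamma>) \<alpha>"
    using P(3)[OF y(1)] by blast
  obtain u where u: "y = \<alpha> \<frown> u" using D[of b] by (auto simp: B_def cyl_def)
  have Bu: "\<beta> \<frown> (\<gamma> \<frown> u) \<in> X" if "\<beta> \<in> B" for \<beta>
    using D[OF that] by (auto simp: cyl_def u)
  let ?z = "b \<frown> (\<gamma> \<frown> u)" and ?h = "k (\<alpha>, \<gamma>)"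
  have zX: "?z \<in> X" by (rule Bu) (simp add: B_def)
  have shift: "?h + g \<in> config X y \<longleftrightarrow> g \<in> config X ?z" for g
    using config_shift[of \<alpha> u X "b @ \<gamma>" g] y(1) zX by (simp add: k_def u)
  have "?h \<in> config X y" using shift[of 0] zero_in_config[OF zX] by simp
  moreover have "?h \<in> H" using p by (auto simp: H_def)
  ultimately have "?h \<in> \<xi>" using y(2) by blast
  moreover have "?h + g \<in> \<xi> \<longleftrightarrow> g \<in> config X x" if g: "g \<in> G" for g
  proof -
    have "?h + g \<in> H" using p g by (auto simp: H_def)
    then have "?h + g \<in> \<xi> \<longleftrightarrow> g \<in> config X ?z" using y(2) shift by blast
    also have "\<dots> \<longleftrightarrow> g \<in> config X x"
    \<comment> \<open>Members persist because \<open>c g\<close> lies in \<open>B\<close>;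
      nonmembers stay out because \<open>?z\<close> shares the prefix of length \<open>m\<close>
      with \<open>x\<close>.\<close>
    proof (cases "g \<in> config X x")
      case True
      then have "c g \<in> B" using g by (simp add: B_def)
      then have "c g \<frown> (\<gamma> \<frown> u) \<in> X" by (rule Bu)
      then have "word b - word (c g) \<in> config X ?z" by (rule in_configI[OF refl])
      then show ?thesis using c[OF g True] True by metis
    next
      case False
      have "prefix m ?z = b"
        by (rule nth_equalityI) (auto simp: b_def conc_def subsequence_def)
      then show ?thesis using neg[OF g False zX] False by (simp add: b_def)
    qed
    finally show ?thesis .
  qed
  ultimately show "\<exists>h\<in>\<xi>. \<forall>g\<in>G. h + g \<in> \<xi> \<longleftrightarrow> g \<in> config X x" by blast
qed

section \<open>Nets and sequences versus finite covers\<close>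

lemma directed_set_finite_upper_bound:
  assumes I: "directed_set I leI" and "finite K" "K \<subseteq> I"
  shows "\<exists>u\<in>I. \<forall>k\<in>K. leI k u"
  using assms(2,3)
proof (induction K rule: finite_induct)
  case empty
  show ?case using I by (auto simp: directed_set_def)
next
  case (insert k K)
  then obtain u where u: "u \<in> I" "\<forall>k\<in>K. leI k u" by auto
  obtain v where v: "v \<in> I" "leI k v" "leI u v"
    using I u insert.prems unfolding directed_set_def by blast
  have "transp_on I leI" using I by (simp add: directed_set_def)
  then have "leI j v" if "j \<in> K" for j
    using that u v insert.prems by (meson insert_subset subsetD transp_onD)
  then show ?case using v by blast
qed

text \<open>If each of finitely many pairs failed from some index on, none would serve at a common
  upper bound. Conversely, if no finite set of pairs covers \<open>X\<close>, uncovered points form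
  a net indexed by these sets; a pair serving cofinally would serve at a set containing it.\<close>

lemma compactly_cofinal_iff_finitely_cofinal: "compactly_cofinal X \<longleftrightarrow> finitely_cofinal X"
proof
  assume "finitely_cofinal X"
  show "compactly_cofinal X"
    unfolding compactly_cofinal_def compactly_cofinal_iff
  proof (intro allI impI)
    fix B and I :: "(nat \<Rightarrow> 'a) net_index set" and leI and x :: "_ \<Rightarrow> nat \<Rightarrow> 'a"
    assume B: "finite B \<and> B \<subseteq> lang X \<and> followers X B \<noteq> {}"
      and net: "directed_set I leI \<and> (\<forall>i\<in>I. x i \<in> X)"
    obtain P where P: "finite P" "P \<subseteq> lang X \<times> lang X"
      "\<And>y. y \<in> X \<Longrightarrow> \<exists>(\<alpha>, \<gamma>)\<in>P. \<forall>\<beta>\<in>B. y \<in> cyl X (\<beta> @ \<gamma>) \<alpha>"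
      using \<open>finitely_cofinal X\<close>[unfolded finitely_cofinal_def, rule_format, OF B] by blast
    show "\<exists>\<alpha>\<in>lang X. \<exists>\<gamma>\<in>lang X. \<forall>i\<in>I. \<exists>k\<in>I. leI i k \<and> (\<forall>\<beta>\<in>B. x k \<in> cyl X (\<beta> @ \<gamma>) \<alpha>)"
    proof (rule ccontr)
      assume no: "\<not> ?thesis"
      have "\<forall>p\<in>P. \<exists>i\<in>I. \<forall>k\<in>I. leI i k \<longrightarrow> \<not> (\<forall>\<beta>\<in>B. x k \<in> cyl X (\<beta> @ snd p) (fst p))"
      proof
        fix p assume "p \<in> P"
        then have "fst p \<in> lang X" "snd p \<in> lang X" using P(2) by auto
        then show "\<exists>i\<in>I. \<forall>k\<in>I. leI i k \<longrightarrow> \<not> (\<forall>\<beta>\<in>B. x k \<in> cyl X (\<beta> @ snd p) (fst p))"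
          using no by blast
      qed
      from bchoice[OF this[unfolded Bex_def]] obtain i where i: "\<And>p. p \<in> P \<Longrightarrow> i p \<in> I"
        "\<And>p k. p \<in> P \<Longrightarrow> k \<in> I \<Longrightarrow> leI (i p) k \<Longrightarrow> \<not> (\<forall>\<beta>\<in>B. x k \<in> cyl X (\<beta> @ snd p) (fst p))"
        by blast
      obtain u where u: "u \<in> I" "\<And>p. p \<in> P \<Longrightarrow> leI (i p) u"
        using directed_set_finite_upper_bound[of I leI "i ` P"] net P(1) i(1) by blast
      obtain p where "p \<in> P" "\<forall>\<beta>\<in>B. x u \<in> cyl X (\<beta> @ snd p) (fst p)"
        using P(3)[of "x u"] net u(1) by auto
      then show False using i(2) u by blast
    qed
  qed
next
  assume cc: "compactly_cofinal X"
  show "finitely_cofinal X"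
    unfolding finitely_cofinal_def
  proof (intro allI impI)
    fix B assume B: "finite B \<and> B \<subseteq> lang X \<and> followers X B \<noteq> {}"
    define cov where "cov P y \<longleftrightarrow> (\<exists>(\<alpha>, \<gamma>)\<in>P. \<forall>\<beta>\<in>B. y \<in> cyl X (\<beta> @ \<gamma>) \<alpha>)" for P y
    show "\<exists>P. finite P \<and> P \<subseteq> lang X \<times> lang X \<and>
      (\<forall>x\<in>X. \<exists>(\<alpha>, \<gamma>)\<in>P. \<forall>\<beta>\<in>B. x \<in> cyl X (\<beta> @ \<gamma>) \<alpha>)"
      unfolding cov_def[symmetric]
    proof (rule ccontr)
      assume "\<not> (\<exists>P. finite P \<and> P \<subseteq> lang X \<times> lang X \<and> (\<forall>x\<in>X. cov P x))"
      then have no: "\<exists>x. x \<in> X \<and> \<not> cov P x" if "finite P" "P \<subseteq> lang X \<times> lang X" for P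
        using that by blast
      define I where "I = {P. finite P \<and> P \<subseteq> lang X \<times> lang X}"
      have "\<forall>P\<in>I. \<exists>x. x \<in> X \<and> \<not> cov P x" using no unfolding I_def by blast
      from bchoice[OF this] obtain x where x: "\<And>P. P \<in> I \<Longrightarrow> x P \<in> X" "\<And>P. P \<in> I \<Longrightarrow> \<not> cov P (x P)"
        by blast
      have "\<exists>R\<in>I. P \<subseteq> R \<and> Q \<subseteq> R" if "P \<in> I" "Q \<in> I" for P Q
        using that by (intro bexI[of _ "P \<union> Q"]) (auto simp: I_def)
      moreover have "{} \<in> I" by (simp add: I_def)
      ultimately have "directed_set I (\<subseteq>)"
        by (auto simp: directed_set_def reflp_on_def transp_on_def)
      with x(1) have net: "directed_set I (\<subseteq>) \<and> (\<forall>P\<in>I. x P \<in> X)" by blast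
      obtain \<alpha> \<gamma> where \<alpha>\<gamma>: "\<alpha> \<in> lang X" "\<gamma> \<in> lang X"
        "\<forall>P\<in>I. \<exists>Q\<in>I. P \<subseteq> Q \<and> (\<forall>\<beta>\<in>B. x Q \<in> cyl X (\<beta> @ \<gamma>) \<alpha>)"
        \<comment> \<open>The indices are sets of pairs of words, so compact cofinality is needed
          for another index type than in its definition.\<close>
        using compactly_cofinal_all_nets[OF cc, unfolded compactly_cofinal_iff, rule_format, OF B net]
        by blast
      have "{(\<alpha>, \<gamma>)} \<in> I" using \<alpha>\<gamma> by (simp add: I_def)
      then obtain Q where "Q \<in> I" "{(\<alpha>, \<gamma>)} \<subseteq> Q" "\<forall>\<beta>\<in>B. x Q \<in> cyl X (\<beta> @ \<gamma>) \<alpha>"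
        using \<alpha>\<gamma>(3) by blast
      then have "cov Q (x Q)" by (auto simp: cov_def)
      then show False using x(2) \<open>Q \<in> I\<close> by blast
    qed
  qed
qed

text \<open>Some pair of a finite cover serves infinitely many terms. Conversely, the pairs of words
  can be listed, and the terms are chosen to avoid longer and longer initial parts of the
  list.\<close>

lemma sequentially_cofinal_iff_finitely_cofinal:
  fixes X :: "(nat \<Rightarrow> 'a) set"
  assumes "countable (UNIV :: 'a set)"
  shows "sequentially_cofinal X \<longleftrightarrow> finitely_cofinal X"
proof
  assume fc: "finitely_cofinal X"
  show "sequentially_cofinal X"
    unfolding sequentially_cofinal_def
  proof (intro allI impI)
    fix B and x :: "nat \<Rightarrow> nat \<Rightarrow> 'a"
    assume B: "finite B \<and> B \<subseteq> lang X \<and> followers X B \<noteq> {}" and x: "\<forall>n. x n \<in> X"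
    obtain P where P: "finite P" "P \<subseteq> lang X \<times> lang X"
      "\<And>y. y \<in> X \<Longrightarrow> \<exists>(\<alpha>, \<gamma>)\<in>P. \<forall>\<beta>\<in>B. y \<in> cyl X (\<beta> @ \<gamma>) \<alpha>"
      using fc[unfolded finitely_cofinal_def, rule_format, OF B] by blast
    define N where "N p = {n. \<forall>\<beta>\<in>B. x n \<in> cyl X (\<beta> @ snd p) (fst p)}" for p
    have "n \<in> (\<Union>p\<in>P. N p)" for n
    proof -
      obtain \<alpha> \<gamma> where "(\<alpha>, \<gamma>) \<in> P" "\<forall>\<beta>\<in>B. x n \<in> cyl X (\<beta> @ \<gamma>) \<alpha>"
        using P(3)[of "x n"] x by auto
      then show ?thesis by (intro UN_I[of "(\<alpha>, \<gamma>)"]) (simp_all add: N_def)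
    qed
    then have "(\<Union>p\<in>P. N p) = UNIV" by blast
    then have "\<not> finite (\<Union>p\<in>P. N p)" by simp
    then obtain p where p: "p \<in> P" "infinite (N p)" using P(1) by blast
    have e: "\<forall>\<beta>\<in>B. x (enumerate (N p) k) \<in> cyl X (\<beta> @ snd p) (fst p)" for k
      using enumerate_in_set[OF p(2), of k] by (simp add: N_def)
    have "fst p \<in> lang X" "snd p \<in> lang X" using p(1) P(2) by auto
    then show "\<exists>\<alpha>\<in>lang X. \<exists>\<gamma>\<in>lang X. \<exists>r :: nat \<Rightarrow> nat. strict_mono r \<and>
        (\<forall>k. \<forall>\<beta>\<in>B. x (r k) \<in> cyl X (\<beta> @ \<gamma>) \<alpha>)"
      by (intro bexI[of _ "fst p"] bexI[of _ "snd p"] exI[of _ "enumerate (N p)"] conjI)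
        (use strict_mono_enumerate[OF p(2)] e in blast)+
  qed
next
  assume sc: "sequentially_cofinal X"
  show "finitely_cofinal X"
    unfolding finitely_cofinal_def
  proof (intro allI impI)
    fix B assume B: "finite B \<and> B \<subseteq> lang X \<and> followers X B \<noteq> {}"
    let ?L = "lang X \<times> lang X"
    have "countable ?L"
      using countable_lists[OF assms] by (auto intro: countable_subset[of _ UNIV] simp: lists_UNIV)
    moreover have ne: "?L \<noteq> {}" by (auto simp: lang_def)
    ultimately have range: "range (from_nat_into ?L) = ?L" by (simp add: range_from_nat_into)
    define cov where "cov P y \<longleftrightarrow> (\<exists>(\<alpha>, \<gamma>)\<in>P. \<forall>\<beta>\<in>B. y \<in> cyl X (\<beta> @ \<gamma>) \<alpha>)" for P y
    show "\<exists>P. finite P \<and> P \<subseteq> ?L \<and> (\<forall>x\<in>X. \<exists>(\<alpha>, \<gamma>)\<in>P. \<forall>\<beta>\<in>B. x \<in> cyl X (\<beta> @ \<gamma>) \<alpha>)"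
      unfolding cov_def[symmetric]
    proof (rule ccontr)
      assume "\<not> (\<exists>P. finite P \<and> P \<subseteq> ?L \<and> (\<forall>x\<in>X. cov P x))"
      then have no: "\<exists>x. x \<in> X \<and> \<not> cov P x" if "finite P" "P \<subseteq> ?L" for P
        using that by blast
      have "\<forall>n. \<exists>y. y \<in> X \<and> \<not> cov (from_nat_into ?L ` {..n}) y"
      proof
        fix n
        have "finite (from_nat_into ?L ` {..n})" "from_nat_into ?L ` {..n} \<subseteq> ?L"
          using range by auto
        then show "\<exists>y. y \<in> X \<and> \<not> cov (from_nat_into ?L ` {..n}) y" by (rule no)
      qed
      from choice[OF this] obtain x where
        x: "\<And>n. x n \<in> X" "\<And>n. \<not> cov (from_nat_into ?L ` {..n}) (x n)"
        by blast
      obtain \<alpha> \<gamma> r where r: "\<alpha> \<in> lang X" "\<gamma> \<in> lang X" "strict_mono (r :: nat \<Rightarrow> nat)"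
        "\<And>k \<beta>. \<beta> \<in> B \<Longrightarrow> x (r k) \<in> cyl X (\<beta> @ \<gamma>) \<alpha>"
        using sc[unfolded sequentially_cofinal_def, rule_format, OF B, of x] x(1) by blast
      have "(\<alpha>, \<gamma>) \<in> range (from_nat_into ?L)" unfolding range using r by simp
      then obtain n where n: "from_nat_into ?L n = (\<alpha>, \<gamma>)" by fastforce
      \<comment> \<open>Hence the pair with index \<open>n\<close> is among those that
        \<open>x (r n)\<close> was chosen to avoid.\<close>
      have "n \<le> r n" using r(3) by (rule strict_mono_imp_increasing)
      then have "(\<alpha>, \<gamma>) \<in> from_nat_into ?L ` {..r n}" using n by (metis atMost_iff imageI)
      then have "cov (from_nat_into ?L ` {..r n}) (x (r n))"
        unfolding cov_def by (rule bexI[rotated]) (simp add: r(4))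
      then show False using x(2) by blast
    qed
  qed
qed

theorem theorem5p23:
  fixes X :: "(nat \<Rightarrow> 'a) set"
  assumes "subshift X"
    and indecomposable: "\<And>e :: 'r::comm_ring_1. e * e = e \<Longrightarrow> e = 0 \<or> e = 1"
  shows "(minimal_theta TYPE('r) X \<longleftrightarrow> compactly_cofinal X) \<and>
    (countable (UNIV :: 'a set) \<longrightarrow>
       (minimal_theta TYPE('r) X \<longleftrightarrow> sequentially_cofinal X))"
proof -
  have "minimal_theta TYPE('r) X \<longleftrightarrow> finitely_cofinal X"
    using minimal_theta_imp_finitely_cofinal finitely_cofinal_imp_minimal_theta assms(1) by blast
  then show ?thesis
    by (simp add: compactly_cofinal_iff_finitely_cofinal sequentially_cofinal_iff_finitely_cofinal)
qed

end
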